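(* Let $\tilde{\mathbb Q}$ be a fixed algebraic closure of $\mathbb Q$, presented in the standard way, and let $M$ be a subfield of $\tilde{\mathbb Q}$. Suppose that $\mathrm{Ex}(M)$, the existential theory of $M$, is decidable (resp. primitively decidable). Then there is a field automorphism $\tau$ of $\tilde{\mathbb Q}$ such that $L=\tau(M)$ is a recursive (resp. primitive recursive) subfield of $\tilde{\mathbb Q}$.
   Context: The standard presentation of $\tilde{\mathbb Q}$: its elements are listed in a primitive recursive sequence such that addition, multiplication, inversion and factorization of polynomials over $\tilde{\mathbb Q}$ are primitive recursive in terms of indices. A subfield $L\subseteq\tilde{\mathbb Q}$ is recursive (resp. primitive recursive) if its characteristic function, as a subset of $\tilde{\mathbb Q}$ in this presentation, is recursive (resp. primitive recursive). $\mathrm{Ex}(M)$ is the set of existential sentences of the language of rings with constant symbols for the elements of $\mathbb Q$ (i.e. sentences equivalent to $(\exists X_1)\cdots(\exists X_n)[\bigvee_i\bigwedge_j f_{ij}(X_1,\dots,X_n)=0]$ with $f_{ij}$ polynomials over $\mathbb Q$) that are true in $M$; it is decidable (resp. primitively decidable) if there is an algorithm (resp. primitive recursive algorithm) deciding for a given such sentence whether it holds in $M$. *)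

theory Defs
  imports "HOL-Library.Nat_Bijection" "HOL-Computational_Algebra.Computational_Algebra"
begin

text \<open>
  An \<open>n\<close>-ary function takes a list of length \<open>n\<close>; values on lists of any other length are
  irrelevant, and the definitions below only look at the right length.
\<close>

inductive prim_rec_fn :: "nat \<Rightarrow> (nat list \<Rightarrow> nat) \<Rightarrow> bool" where
  zero: "prim_rec_fn n (\<lambda>xs. 0)"
| succ: "prim_rec_fn 1 (\<lambda>xs. Suc (xs ! 0))"
| proj: "i < n \<Longrightarrow> prim_rec_fn n (\<lambda>xs. xs ! i)"
| comp: "prim_rec_fn (length gs) f \<Longrightarrow> \<forall>g\<in>set gs. prim_rec_fn n g
    \<Longrightarrow> prim_rec_fn n (\<lambda>xs. f (map (\<lambda>g. g xs) gs))"
| prec: "prim_rec_fn n f \<Longrightarrow> prim_rec_fn (n + 2) g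
    \<Longrightarrow> prim_rec_fn (Suc n) (\<lambda>xs. rec_nat (f (tl xs)) (\<lambda>y r. g (y # r # tl xs)) (hd xs))"

text \<open>
  Unbounded minimisation is restricted to regular functions. By Kleene's normal form theorem the
  functions obtained are exactly the total recursive ones.
\<close>

inductive recursive_fn :: "nat \<Rightarrow> (nat list \<Rightarrow> nat) \<Rightarrow> bool" where
  zero: "recursive_fn n (\<lambda>xs. 0)"
| succ: "recursive_fn 1 (\<lambda>xs. Suc (xs ! 0))"
| proj: "i < n \<Longrightarrow> recursive_fn n (\<lambda>xs. xs ! i)"
| comp: "recursive_fn (length gs) f \<Longrightarrow> \<forall>g\<in>set gs. recursive_fn n g
    \<Longrightarrow> recursive_fn n (\<lambda>xs. f (map (\<lambda>g. g xs) gs))"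
| prec: "recursive_fn n f \<Longrightarrow> recursive_fn (n + 2) g
    \<Longrightarrow> recursive_fn (Suc n) (\<lambda>xs. rec_nat (f (tl xs)) (\<lambda>y r. g (y # r # tl xs)) (hd xs))"
| mini: "recursive_fn (Suc n) f \<Longrightarrow> \<forall>xs. length xs = n \<longrightarrow> (\<exists>y. f (y # xs) = 0)
    \<Longrightarrow> recursive_fn n (\<lambda>xs. LEAST y. f (y # xs) = 0)"

definition prim_rec1 :: "(nat \<Rightarrow> nat) \<Rightarrow> bool" where
  "prim_rec1 h \<longleftrightarrow> (\<exists>f. prim_rec_fn 1 f \<and> (\<forall>x. f [x] = h x))"

definition prim_rec2 :: "(nat \<Rightarrow> nat \<Rightarrow> nat) \<Rightarrow> bool" where
  "prim_rec2 h \<longleftrightarrow> (\<exists>f. prim_rec_fn 2 f \<and> (\<forall>x y. f [x, y] = h x y))"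

definition prim_rec_set :: "nat set \<Rightarrow> bool" where
  "prim_rec_set A \<longleftrightarrow> (\<exists>f. prim_rec_fn 1 f \<and> (\<forall>x. f [x] = of_bool (x \<in> A)))"

definition recursive_set :: "nat set \<Rightarrow> bool" where
  "recursive_set A \<longleftrightarrow> (\<exists>f. recursive_fn 1 f \<and> (\<forall>x. f [x] = of_bool (x \<in> A)))"

definition is_subfield :: "'a::field set \<Rightarrow> bool" where
  "is_subfield K \<longleftrightarrow> 0 \<in> K \<and> 1 \<in> K \<and>
     (\<forall>x\<in>K. \<forall>y\<in>K. x + y \<in> K \<and> x * y \<in> K) \<and> (\<forall>x\<in>K. - x \<in> K \<and> inverse x \<in> K)"

definition field_automorphism :: "('a::field \<Rightarrow> 'a) \<Rightarrow> bool" where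
  "field_automorphism \<tau> \<longleftrightarrow> bij \<tau> \<and> \<tau> 0 = 0 \<and> \<tau> 1 = 1 \<and>
     (\<forall>x y. \<tau> (x + y) = \<tau> x + \<tau> y) \<and> (\<forall>x y. \<tau> (x * y) = \<tau> x * \<tau> y)"

text \<open>
  A natural number codes a polynomial through the list of (indices of) its coefficients, constant
  term first; trailing zero coefficients are allowed.
\<close>

definition index_poly :: "(nat \<Rightarrow> 'a::field) \<Rightarrow> nat \<Rightarrow> 'a poly" where
  "index_poly e c = Poly (map e (list_decode c))"

definition int_index_poly :: "nat \<Rightarrow> 'a::field poly" where
  "int_index_poly c = Poly (map (\<lambda>k. of_int (int_decode k)) (list_decode c))"

text \<open>
  The sequence \<open>e\<close> lists all elements, possibly with repetitions. The clause on \<open>int_index_poly\<close>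
  says that the sequence itself is primitive recursive: the \<open>i\<close>-th element is effectively given as
  an algebraic number, by an equation over the integers that it satisfies. The arithmetic clauses
  alone do not bound the size of such an equation by a primitive recursive function of \<open>i\<close>.
  Equality of elements need not be assumed decidable: \<open>a = 0\<close> iff the polynomial \<open>1 + a X\<close> has no
  irreducible factor.
\<close>

definition standard_presentation :: "(nat \<Rightarrow> 'a::field) \<Rightarrow> bool" where
  "standard_presentation e \<longleftrightarrow>
     range e = UNIV \<and>
     (\<exists>eqn. prim_rec1 eqn \<and>
        (\<forall>i. int_index_poly (eqn i) \<noteq> (0 :: 'a poly) \<and> poly (int_index_poly (eqn i)) (e i) = 0)) \<and>
     (\<exists>add. prim_rec2 add \<and> (\<forall>i j. e (add i j) = e i + e j)) \<and>
     (\<exists>mul. prim_rec2 mul \<and> (\<forall>i j. e (mul i j) = e i * e j)) \<and>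
     (\<exists>inv. prim_rec1 inv \<and> (\<forall>i. e i \<noteq> 0 \<longrightarrow> e (inv i) = inverse (e i))) \<and>
     (\<exists>fac. prim_rec1 fac \<and>
        (\<forall>c. index_poly e c \<noteq> 0 \<longrightarrow>
           (let fs = map (index_poly e) (list_decode (fac c)) in
              (\<forall>f\<in>set fs. irreducible f \<and> lead_coeff f = 1) \<and>
              index_poly e c = smult (lead_coeff (index_poly e c)) (prod_list fs))))"

definition recursive_subfield :: "(nat \<Rightarrow> 'a::field) \<Rightarrow> 'a set \<Rightarrow> bool" where
  "recursive_subfield e L \<longleftrightarrow> is_subfield L \<and> recursive_set {i. e i \<in> L}"

definition prim_rec_subfield :: "(nat \<Rightarrow> 'a::field) \<Rightarrow> 'a set \<Rightarrow> bool" where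
  "prim_rec_subfield e L \<longleftrightarrow> is_subfield L \<and> prim_rec_set {i. e i \<in> L}"

datatype rterm =
    TVar nat
  | TConst rat
  | TNeg rterm
  | TAdd rterm rterm
  | TMul rterm rterm

datatype qf_form =
    FEq rterm rterm
  | FNot qf_form
  | FAnd qf_form qf_form
  | FOr qf_form qf_form

text \<open>\<open>Exists n \<phi>\<close> stands for \<open>\<exists>X\<^sub>0 \<dots> X\<^sub>n\<^sub>-\<^sub>1. \<phi>\<close>.\<close>

datatype ex_form = Exists nat qf_form

primrec term_vars :: "rterm \<Rightarrow> nat set" where
  "term_vars (TVar i) = {i}"
| "term_vars (TConst q) = {}"
| "term_vars (TNeg s) = term_vars s"
| "term_vars (TAdd s t) = term_vars s \<union> term_vars t"
| "term_vars (TMul s t) = term_vars s \<union> term_vars t"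

primrec form_vars :: "qf_form \<Rightarrow> nat set" where
  "form_vars (FEq s t) = term_vars s \<union> term_vars t"
| "form_vars (FNot \<phi>) = form_vars \<phi>"
| "form_vars (FAnd \<phi> \<psi>) = form_vars \<phi> \<union> form_vars \<psi>"
| "form_vars (FOr \<phi> \<psi>) = form_vars \<phi> \<union> form_vars \<psi>"

fun ex_sentence :: "ex_form \<Rightarrow> bool" where
  "ex_sentence (Exists n \<phi>) \<longleftrightarrow> form_vars \<phi> \<subseteq> {..<n}"

primrec term_val :: "(nat \<Rightarrow> 'a::field_char_0) \<Rightarrow> rterm \<Rightarrow> 'a" where
  "term_val v (TVar i) = v i"
| "term_val v (TConst q) = of_rat q"
| "term_val v (TNeg s) = - term_val v s"
| "term_val v (TAdd s t) = term_val v s + term_val v t"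
| "term_val v (TMul s t) = term_val v s * term_val v t"

primrec form_holds :: "(nat \<Rightarrow> 'a::field_char_0) \<Rightarrow> qf_form \<Rightarrow> bool" where
  "form_holds v (FEq s t) \<longleftrightarrow> term_val v s = term_val v t"
| "form_holds v (FNot \<phi>) \<longleftrightarrow> \<not> form_holds v \<phi>"
| "form_holds v (FAnd \<phi> \<psi>) \<longleftrightarrow> form_holds v \<phi> \<and> form_holds v \<psi>"
| "form_holds v (FOr \<phi> \<psi>) \<longleftrightarrow> form_holds v \<phi> \<or> form_holds v \<psi>"

fun true_in :: "'a::field_char_0 set \<Rightarrow> ex_form \<Rightarrow> bool" where
  "true_in M (Exists n \<phi>) \<longleftrightarrow> (\<exists>v. (\<forall>i<n. v i \<in> M) \<and> form_holds v \<phi>)"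

definition Ex_theory :: "'a::field_char_0 set \<Rightarrow> ex_form set" where
  "Ex_theory M = {\<sigma>. ex_sentence \<sigma> \<and> true_in M \<sigma>}"

definition rat_encode :: "rat \<Rightarrow> nat" where
  "rat_encode q = (case quotient_of q of (a, b) \<Rightarrow> prod_encode (int_encode a, nat b))"

primrec term_encode :: "rterm \<Rightarrow> nat" where
  "term_encode (TVar i) = prod_encode (0, i)"
| "term_encode (TConst q) = prod_encode (1, rat_encode q)"
| "term_encode (TNeg s) = prod_encode (2, term_encode s)"
| "term_encode (TAdd s t) = prod_encode (3, prod_encode (term_encode s, term_encode t))"
| "term_encode (TMul s t) = prod_encode (4, prod_encode (term_encode s, term_encode t))"

primrec form_encode :: "qf_form \<Rightarrow> nat" where
  "form_encode (FEq s t) = prod_encode (0, prod_encode (term_encode s, term_encode t))"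
| "form_encode (FNot \<phi>) = prod_encode (1, form_encode \<phi>)"
| "form_encode (FAnd \<phi> \<psi>) = prod_encode (2, prod_encode (form_encode \<phi>, form_encode \<psi>))"
| "form_encode (FOr \<phi> \<psi>) = prod_encode (3, prod_encode (form_encode \<phi>, form_encode \<psi>))"

fun sentence_encode :: "ex_form \<Rightarrow> nat" where
  "sentence_encode (Exists n \<phi>) = prod_encode (n, form_encode \<phi>)"

lemma rat_encode_eq_iff: "rat_encode p = rat_encode q \<longleftrightarrow> p = q"
proof
  assume eq: "rat_encode p = rat_encode q"
  obtain a b where p: "quotient_of p = (a, b)" by fastforce
  obtain c d where q: "quotient_of q = (c, d)" by fastforce
  have "b > 0" "d > 0" using p q quotient_of_denom_pos by blast+
  with eq p q have "quotient_of p = quotient_of q"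
    by (auto simp: rat_encode_def inj_eq [OF inj_int_encode])
  then show "p = q" by (simp add: quotient_of_inject)
qed simp

lemma term_encode_eq_iff: "term_encode s = term_encode t \<longleftrightarrow> s = t"
proof (induction s arbitrary: t)
  case (TVar i) then show ?case by (cases t) auto
next
  case (TConst q) then show ?case by (cases t) (auto simp: rat_encode_eq_iff)
next
  case (TNeg s) then show ?case by (cases t) auto
next
  case (TAdd s1 s2) then show ?case by (cases t) auto
next
  case (TMul s1 s2) then show ?case by (cases t) auto
qed

lemma form_encode_eq_iff: "form_encode \<phi> = form_encode \<psi> \<longleftrightarrow> \<phi> = \<psi>"
proof (induction \<phi> arbitrary: \<psi>)
  case (FEq s t) then show ?case by (cases \<psi>) (auto simp: term_encode_eq_iff)
next
  case (FNot \<phi>) then show ?case by (cases \<psi>) auto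
next
  case (FAnd \<phi>1 \<phi>2) then show ?case by (cases \<psi>) auto
next
  case (FOr \<phi>1 \<phi>2) then show ?case by (cases \<psi>) auto
qed

lemma inj_sentence_encode: "inj sentence_encode"
proof (rule injI)
  fix \<sigma> \<rho> assume "sentence_encode \<sigma> = sentence_encode \<rho>"
  then show "\<sigma> = \<rho>" by (cases \<sigma>; cases \<rho>) (auto simp: form_encode_eq_iff)
qed

text \<open>
  Being the code of a sentence is a primitive recursive property, so deciding truth of a given
  sentence amounts to deciding the set of codes of true sentences.
\<close>

definition Ex_decidable :: "'a::field_char_0 set \<Rightarrow> bool" where
  "Ex_decidable M \<longleftrightarrow> recursive_set (sentence_encode ` Ex_theory M)"

definition Ex_prim_decidable :: "'a::field_char_0 set \<Rightarrow> bool" where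
  "Ex_prim_decidable M \<longleftrightarrow> prim_rec_set (sentence_encode ` Ex_theory M)"

end

theory Submission
  imports Defs
begin

text \<open>
  Go through the indices in order and accept \<open>i\<close> if some automorphism of the algebraic closure
  moves \<open>e i\<close> and all elements accepted before it into \<open>M\<close>. By compactness one automorphism \<open>\<sigma>\<close>
  works for all accepted elements, and it moves no rejected element into \<open>M\<close>; so the accepted
  elements form \<open>\<sigma>\<^sup>-\<^sup>1(M)\<close>, and it remains to decide the acceptance condition.

  A single element \<open>a\<close> can be moved into \<open>M\<close> iff \<open>M\<close> contains a root of every integer polynomial
  that vanishes at \<open>a\<close>. It suffices to ask this for polynomials whose codes are bounded in terms of
  a given equation \<open>f(a) = 0\<close>, since the primitive minimal polynomial of \<open>a\<close> divides \<open>f\<close> and the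
  complex roots of \<open>f\<close> bound its coefficients. Finitely many elements \<open>a\<^sub>0, \<dots>, a\<^sub>k\<^sub>-\<^sub>1\<close> can be
  moved into \<open>M\<close> simultaneously iff each of the elements \<open>a\<^sub>0 + t a\<^sub>1 + \<dots> + t\<^sup>k\<^sup>-\<^sup>1 a\<^sub>k\<^sub>-\<^sub>1\<close> can,
  for \<open>t\<close> up to a computable bound. All searches are bounded, so the same procedure serves the
  recursive and the primitive recursive case.
\<close>

section \<open>Closure properties of the recursive functions\<close>

abbreviation "pfst z \<equiv> fst (prod_decode z)"
abbreviation "psnd z \<equiv> snd (prod_decode z)"

text \<open>The Cantor pairing dominates both components, so a list code dominates everything read
  off from it. This supplies the number of steps for recursions over coded lists and bounds the
  degree and the coefficients of coded polynomials.\<close>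

lemma list_decode_bounds:
  shows length_list_decode_le: "length (list_decode n) \<le> n"
    and set_list_decode_le: "k \<in> set (list_decode n) \<Longrightarrow> k \<le> n"
proof -
  have "length (list_decode n) \<le> n \<and> (\<forall>k\<in>set (list_decode n). k \<le> n)"
  proof (induction n rule: list_decode.induct)
    case (2 n)
    obtain u v where n: "prod_decode n = (u, v)" by fastforce
    then have "u \<le> n" "v \<le> n"
      using le_prod_encode_1 [of u v] le_prod_encode_2 [of v u] prod_decode_inverse [of n] by simp_all
    with 2 [OF n [symmetric]] show ?case by (auto simp: n)
  qed simp
  then show "length (list_decode n) \<le> n" "k \<in> set (list_decode n) \<Longrightarrow> k \<le> n" by blast+
qed

text \<open>Abstracts what the primitive recursive and the recursive functions share, so that each
  computability argument is given once and then instantiated for both classes.\<close>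

locale function_class =
  fixes C :: "nat \<Rightarrow> (nat list \<Rightarrow> nat) \<Rightarrow> bool"
  assumes zero: "C n (\<lambda>xs. 0)"
    and succ: "C 1 (\<lambda>xs. Suc (xs ! 0))"
    and proj: "i < n \<Longrightarrow> C n (\<lambda>xs. xs ! i)"
    and comp: "C (length gs) f \<Longrightarrow> \<forall>g\<in>set gs. C n g
      \<Longrightarrow> C n (\<lambda>xs. f (map (\<lambda>g. g xs) gs))"
    and prec: "C n f \<Longrightarrow> C (n + 2) g
      \<Longrightarrow> C (Suc n) (\<lambda>xs. rec_nat (f (tl xs)) (\<lambda>y r. g (y # r # tl xs)) (hd xs))"
begin

section \<open>Functions of fixed arity and closure under composition\<close>

lemma prim_rec_fn_imp: "prim_rec_fn n f \<Longrightarrow> C n f"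
proof (induction rule: prim_rec_fn.induct)
  case (comp gs f n)
  then show ?case by (intro function_class.comp [OF function_class_axioms]) auto
qed (auto intro: zero proj prec succ [simplified])

text \<open>Agreement is demanded only on lists of length \<open>n\<close>: \<open>comp\<close> and
  \<open>prec\<close> yield functions of a rigid shape, which match the intended ones only
  there.\<close>

definition comp_fn :: "nat \<Rightarrow> (nat list \<Rightarrow> nat) \<Rightarrow> bool" where
  "comp_fn n h \<longleftrightarrow> (\<exists>f. C n f \<and> (\<forall>xs. length xs = n \<longrightarrow> f xs = h xs))"

definition comp1 :: "(nat \<Rightarrow> nat) \<Rightarrow> bool" where
  "comp1 h \<longleftrightarrow> (\<exists>f. C 1 f \<and> (\<forall>x. f [x] = h x))"

definition comp2 :: "(nat \<Rightarrow> nat \<Rightarrow> nat) \<Rightarrow> bool" where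
  "comp2 h \<longleftrightarrow> (\<exists>f. C 2 f \<and> (\<forall>x y. f [x, y] = h x y))"

definition comp3 :: "(nat \<Rightarrow> nat \<Rightarrow> nat \<Rightarrow> nat) \<Rightarrow> bool" where
  "comp3 h \<longleftrightarrow> (\<exists>f. C 3 f \<and> (\<forall>x y z. f [x, y, z] = h x y z))"

lemma prim_rec1_imp: "prim_rec1 h \<Longrightarrow> comp1 h"
  unfolding prim_rec1_def comp1_def using prim_rec_fn_imp by blast

lemma prim_rec2_imp: "prim_rec2 h \<Longrightarrow> comp2 h"
  unfolding prim_rec2_def comp2_def using prim_rec_fn_imp by blast

lemma comp_fn_comp:
  assumes "C (length gs) f" "\<forall>g\<in>set gs. comp_fn n g"
  shows "comp_fn n (\<lambda>xs. f (map (\<lambda>g. g xs) gs))"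
proof -
  from assms(2) obtain F where F: "\<forall>g\<in>set gs. C n (F g) \<and> (\<forall>xs. length xs = n \<longrightarrow> F g xs = g xs)"
    unfolding comp_fn_def by metis
  have "C n (\<lambda>xs. f (map (\<lambda>g. g xs) (map F gs)))"
    using assms F by (intro comp) auto
  moreover have eq: "map (\<lambda>g. g xs) (map F gs) = map (\<lambda>g. g xs) gs" if "length xs = n" for xs
    using F that by auto
  ultimately show ?thesis unfolding comp_fn_def by (intro exI conjI allI impI) (assumption, simp only: eq)
qed

lemma comp_fn_comp1:
  assumes "comp1 f" "comp_fn n a"
  shows "comp_fn n (\<lambda>xs. f (a xs))"
proof -
  obtain F where F: "C 1 F" "\<And>x. F [x] = f x" using assms(1) unfolding comp1_def by blast
  have "comp_fn n (\<lambda>xs. F (map (\<lambda>g. g xs) [a]))"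
    using assms F by (intro comp_fn_comp) auto
  then show ?thesis by (simp add: F)
qed

lemma comp_fn_comp2:
  assumes "comp2 f" "comp_fn n a" "comp_fn n b"
  shows "comp_fn n (\<lambda>xs. f (a xs) (b xs))"
proof -
  obtain F where F: "C 2 F" "\<And>x y. F [x, y] = f x y" using assms(1) unfolding comp2_def by blast
  have "comp_fn n (\<lambda>xs. F (map (\<lambda>g. g xs) [a, b]))"
    using assms F by (intro comp_fn_comp) (auto simp: numeral_2_eq_2)
  then show ?thesis by (simp add: F)
qed

lemma comp_fn_comp3:
  assumes "comp3 f" "comp_fn n a" "comp_fn n b" "comp_fn n c"
  shows "comp_fn n (\<lambda>xs. f (a xs) (b xs) (c xs))"
proof -
  obtain F where F: "C 3 F" "\<And>x y z. F [x, y, z] = f x y z"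
    using assms(1) unfolding comp3_def by blast
  have "comp_fn n (\<lambda>xs. F (map (\<lambda>g. g xs) [a, b, c]))"
    using assms F by (intro comp_fn_comp) (auto simp: numeral_3_eq_3)
  then show ?thesis by (simp add: F)
qed

lemma comp_fn_proj: "i < n \<Longrightarrow> comp_fn n (\<lambda>xs. xs ! i)"
  unfolding comp_fn_def using proj by blast

lemma comp1_iff: "comp1 f \<longleftrightarrow> comp_fn 1 (\<lambda>xs. f (xs ! 0))"
proof
  assume "comp1 f"
  then show "comp_fn 1 (\<lambda>xs. f (xs ! 0))" by (rule comp_fn_comp1) (simp add: comp_fn_proj)
next
  assume "comp_fn 1 (\<lambda>xs. f (xs ! 0))"
  then show "comp1 f" unfolding comp1_def comp_fn_def by (metis One_nat_def length_Cons list.size(3) nth_Cons_0)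
qed

lemma comp2I: "comp_fn 2 (\<lambda>xs. f (xs ! 0) (xs ! 1)) \<Longrightarrow> comp2 f"
  unfolding comp2_def comp_fn_def by fastforce

lemma comp3I: "comp_fn 3 (\<lambda>xs. f (xs ! 0) (xs ! 1) (xs ! 2)) \<Longrightarrow> comp3 f"
  unfolding comp3_def comp_fn_def by fastforce

lemma comp1_Suc: "comp1 Suc"
  unfolding comp1_def using succ by auto

lemma comp_fn_const: "comp_fn n (\<lambda>xs. c)"
proof (induction c)
  case 0
  then show ?case unfolding comp_fn_def using zero by blast
next
  case (Suc c)
  then show ?case using comp_fn_comp1 [OF comp1_Suc] by blast
qed

lemma comp1_rec:
  assumes "comp2 g"
  shows "comp1 (rec_nat c g)"
proof -
  obtain G where G: "C 2 G" "\<And>x y. G [x, y] = g x y" using assms unfolding comp2_def by blast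
  obtain F where F: "C 0 F" "F [] = c" using comp_fn_const [of 0 c] unfolding comp_fn_def by auto
  have "C (Suc 0) (\<lambda>xs. rec_nat (F (tl xs)) (\<lambda>y r. G (y # r # tl xs)) (hd xs))"
    using F G by (intro prec) (auto simp: numeral_2_eq_2)
  then show ?thesis unfolding comp1_def
    by (intro exI conjI) (auto simp: F G)
qed

lemma comp2_rec:
  assumes "comp1 a" "comp3 g"
  shows "comp2 (\<lambda>m x. rec_nat (a x) (\<lambda>y r. g y r x) m)"
proof -
  obtain G where G: "C 3 G" "\<And>x y z. G [x, y, z] = g x y z" using assms unfolding comp3_def by blast
  obtain F where F: "C 1 F" "\<And>x. F [x] = a x" using assms unfolding comp1_def by blast
  have "C (Suc 1) (\<lambda>xs. rec_nat (F (tl xs)) (\<lambda>y r. G (y # r # tl xs)) (hd xs))"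
    using F G by (intro prec) (auto simp: numeral_3_eq_3)
  then show ?thesis unfolding comp2_def numeral_2_eq_2
    by (intro exI conjI) (auto simp: F G)
qed

lemma comp1_id: "comp1 (\<lambda>x. x)"
  by (simp add: comp1_iff comp_fn_proj)

lemma comp2_cong: "comp2 f \<Longrightarrow> (\<And>x y. f x y = g x y) \<Longrightarrow> comp2 g"
  unfolding comp2_def by simp

lemma comp2_flip:
  assumes "comp2 f" shows "comp2 (\<lambda>x y. f y x)"
  by (intro comp2I comp_fn_comp2 [OF assms] comp_fn_proj) auto

section \<open>Arithmetic and conditionals\<close>

lemma comp2_add: "comp2 (\<lambda>m n. m + n)"
proof (rule comp2_cong)
  show "comp2 (\<lambda>m x. rec_nat x (\<lambda>y r. Suc r) m)"
    by (intro comp2_rec comp1_id comp3I comp_fn_comp1 [OF comp1_Suc] comp_fn_proj) auto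
  show "rec_nat x (\<lambda>y r. Suc r) m = m + x" for m x by (induction m) auto
qed

lemma comp2_mult: "comp2 (\<lambda>m n. m * n)"
proof (rule comp2_cong)
  show "comp2 (\<lambda>m x. rec_nat 0 (\<lambda>y r. x + r) m)"
    by (intro comp2_rec comp1_iff [THEN iffD2] comp3I comp_fn_comp2 [OF comp2_add] comp_fn_proj comp_fn_const) auto
  show "rec_nat 0 (\<lambda>y r. x + r) m = m * x" for m x by (induction m) auto
qed

lemma comp1_pred: "comp1 (\<lambda>n. n - 1)"
proof -
  have "comp1 (rec_nat 0 (\<lambda>y r. y))"
    by (intro comp1_rec comp2I comp_fn_proj) auto
  moreover have "rec_nat 0 (\<lambda>y r. y) = (\<lambda>n. n - 1)" 
  proof
    show "rec_nat 0 (\<lambda>y r. y) n = n - 1" for n by (induction n) auto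
  qed
  ultimately show ?thesis by simp
qed

lemma comp2_diff: "comp2 (\<lambda>m n. m - n)"
proof (rule comp2_cong)
  \<comment> \<open>Subtraction iterates the predecessor. The recursion runs on the first argument,
    which here is the subtrahend, so the arguments are swapped afterwards.\<close>
  have "comp2 (\<lambda>m x. rec_nat x (\<lambda>y r. r - 1) m)"
    by (intro comp2_rec comp1_id comp3I comp_fn_comp1 [OF comp1_pred] comp_fn_proj) auto
  then show "comp2 (\<lambda>m x. rec_nat m (\<lambda>y r. r - 1) x)"
    by (rule comp2_flip)
  show "rec_nat m (\<lambda>y r. r - 1) x = m - x" for m x by (induction x) simp_all
qed

lemma comp3_if: "comp3 (\<lambda>c a b. if c = 0 then a else b)"
proof (rule comp3I)
  \<comment> \<open>With truncated subtraction, \<open>1 - c\<close> is the indicator of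
    \<open>c = 0\<close> and \<open>1 - (1 - c)\<close> that of its negation.\<close>
  have "comp_fn 3 (\<lambda>xs. xs ! 1 * (1 - xs ! 0) + xs ! 2 * (1 - (1 - xs ! 0)))"
    by (intro comp_fn_comp2 [OF comp2_add] comp_fn_comp2 [OF comp2_mult] comp_fn_comp2 [OF comp2_diff]
        comp_fn_proj comp_fn_const) auto
  moreover have "(\<lambda>xs. xs ! 1 * (1 - xs ! 0) + xs ! 2 * (1 - (1 - xs ! 0))) =
      (\<lambda>xs. if xs ! 0 = 0 then xs ! 1 else xs ! 2 :: nat)" by auto
  ultimately show "comp_fn 3 (\<lambda>xs. if xs ! 0 = 0 then xs ! 1 else xs ! 2)" by simp
qed

lemma comp1_comp1: "comp1 f \<Longrightarrow> comp1 a \<Longrightarrow> comp1 (\<lambda>x. f (a x))"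
  unfolding comp1_iff [of "\<lambda>x. f (a x)"] comp1_iff [of a] by (rule comp_fn_comp1)

lemma comp1_comp2: "comp2 f \<Longrightarrow> comp1 a \<Longrightarrow> comp1 b \<Longrightarrow> comp1 (\<lambda>x. f (a x) (b x))"
  unfolding comp1_iff by (rule comp_fn_comp2)

lemma comp1_const: "comp1 (\<lambda>x. c)"
  by (simp add: comp1_iff comp_fn_const)

lemma comp1_if0: "comp1 c \<Longrightarrow> comp1 a \<Longrightarrow> comp1 b \<Longrightarrow> comp1 (\<lambda>x. if c x = 0 then a x else b x)"
  unfolding comp1_iff by (rule comp_fn_comp3 [OF comp3_if])

section \<open>The Cantor pairing function and its inverses\<close>

lemma comp1_triangle: "comp1 triangle"
proof -
  have "comp1 (rec_nat 0 (\<lambda>y r. r + Suc y))"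
    by (intro comp1_rec comp2I comp_fn_comp2 [OF comp2_add] comp_fn_comp1 [OF comp1_Suc] comp_fn_proj) auto
  moreover have "rec_nat 0 (\<lambda>y r. r + Suc y) = triangle"
  proof
    show "rec_nat 0 (\<lambda>y r. r + Suc y) n = triangle n" for n by (induction n) auto
  qed
  ultimately show ?thesis by simp
qed

text \<open>The sum of the components of \<open>z\<close> numbers its diagonal, that is, it is the
  largest \<open>s\<close> with \<open>triangle s\<close> at most \<open>z\<close>. Recursion on
  \<open>z\<close> raises \<open>s\<close> by one whenever the next triangular number is reached.
  Both components can be recovered from the diagonal.\<close>

lemma comp1_triangle_root: "comp1 (\<lambda>z. pfst z + psnd z)"
proof -
  define s where "s = rec_nat 0 (\<lambda>y r. if triangle (Suc r) - Suc y = 0 then Suc r else r)"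
  have "comp1 s" unfolding s_def
    by (intro comp1_rec comp2I comp_fn_comp3 [OF comp3_if] comp_fn_comp2 [OF comp2_diff]
        comp_fn_comp1 [OF comp1_triangle] comp_fn_comp1 [OF comp1_Suc] comp_fn_proj) auto
  moreover have "s = (\<lambda>z. pfst z + psnd z)"
  proof
    fix z
    have s: "triangle (s z) \<le> z \<and> z < triangle (Suc (s z))"
    proof (induction z)
      case (Suc z)
      have "s (Suc z) = (if triangle (Suc (s z)) \<le> Suc z then Suc (s z) else s z)"
        by (simp add: s_def del: triangle_Suc)
      moreover have "triangle (Suc (Suc (s z))) = triangle (Suc (s z)) + Suc (Suc (s z))"
        by (rule triangle_Suc)
      ultimately show ?case using Suc
        by (cases "triangle (Suc (s z)) \<le> Suc z"; simp only: if_True if_False; linarith)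
    qed (simp add: s_def)
    obtain a b where z: "prod_decode z = (a, b)" by fastforce
    then have "z = triangle (a + b) + a" 
      using prod_decode_inverse [of z] by (simp add: prod_encode_def)
    then have t: "triangle (a + b) \<le> z \<and> z < triangle (Suc (a + b))" by simp
    have mono: "triangle i \<le> triangle j" if "i \<le> j" for i j
      using that by (rule lift_Suc_mono_le [of triangle, rotated]) simp
    have "\<not> Suc (s z) \<le> a + b" "\<not> Suc (a + b) \<le> s z" using mono [of "Suc (s z)" "a + b"] mono [of "Suc (a + b)" "s z"] s t by linarith+
    then show "s z = pfst z + psnd z" by (simp add: z)
  qed
  ultimately show ?thesis by simp
qed

lemma comp1_pfst': "comp1 (\<lambda>z. pfst z)"
proof -
  have "comp1 (\<lambda>z. z - triangle (pfst z + psnd z))"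
    by (intro comp1_comp2 [OF comp2_diff] comp1_comp1 [OF comp1_triangle] comp1_triangle_root comp1_id)
  moreover have "z - triangle (pfst z + psnd z) = pfst z" for z
    using prod_decode_inverse [of z] unfolding prod_encode_def by (cases "prod_decode z") simp
  ultimately show ?thesis by simp
qed

lemma comp1_psnd': "comp1 (\<lambda>z. psnd z)"
proof -
  have "comp1 (\<lambda>z. (pfst z + psnd z) - pfst z)"
    by (intro comp1_comp2 [OF comp2_diff] comp1_triangle_root comp1_pfst')
  then show ?thesis by simp
qed

lemmas comp1_pfst = comp1_comp1 [OF comp1_pfst']
lemmas comp1_psnd = comp1_comp1 [OF comp1_psnd']

lemma comp1_pair:
  assumes "comp1 a" "comp1 b"
  shows "comp1 (\<lambda>x. prod_encode (a x, b x))"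
proof -
  have "comp1 (\<lambda>x. triangle (a x + b x) + a x)"
    by (intro comp1_comp2 [OF comp2_add] comp1_comp1 [OF comp1_triangle] assms)
  then show ?thesis by (simp add: prod_encode_def)
qed

text \<open>The step function of three arguments is presented as a unary function of a nested pair.
  Thus everything later, parameters included, can be handled by introduction rules for
  \<open>comp1\<close> alone.\<close>

lemma comp1_rec_nat:
  assumes "comp1 m" "comp1 a" "comp1 (\<lambda>z. b (pfst z) (pfst (psnd z)) (psnd (psnd z)))"
  shows "comp1 (\<lambda>x. rec_nat (a x) (\<lambda>y r. b y r x) (m x))"
proof -
  have "comp_fn 3 (\<lambda>xs. prod_encode (xs ! 0, prod_encode (xs ! 1, xs ! 2)))"
    by (simp add: prod_encode_def)
      (intro comp_fn_comp2 [OF comp2_add] comp_fn_comp1 [OF comp1_triangle] comp_fn_proj; simp)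
  from comp_fn_comp1 [OF assms(3) this] have "comp3 b" by (intro comp3I) simp
  from comp1_comp2 [OF comp2_rec [OF assms(2) this] assms(1) comp1_id] show ?thesis .
qed

section \<open>Decidable predicates, bounded quantifiers and coded lists\<close>

lemmas comp1_arith =
  comp1_comp1 [OF comp1_Suc] comp1_comp2 [OF comp2_add]
  comp1_comp2 [OF comp2_mult] comp1_comp2 [OF comp2_diff]

lemma comp1_if:
  assumes "comp1 (\<lambda>x. of_bool (P x))" "comp1 a" "comp1 b"
  shows "comp1 (\<lambda>x. if P x then a x else b x)"
proof -
  have "comp1 (\<lambda>x. if of_bool (P x) = (0::nat) then b x else a x)"
    using assms by (intro comp1_if0)
  moreover have "(\<lambda>x. if of_bool (P x) = (0::nat) then b x else a x) = (\<lambda>x. if P x then a x else b x)"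
    by auto
  ultimately show ?thesis by simp
qed

lemma comp1_eq0:
  assumes "comp1 a" shows "comp1 (\<lambda>x. of_bool (a x = 0))"
proof -
  have "comp1 (\<lambda>x. 1 - a x)" by (intro comp1_arith comp1_const assms)
  moreover have "(\<lambda>x. 1 - a x) = (\<lambda>x. of_bool (a x = 0))" by (auto simp: fun_eq_iff)
  ultimately show ?thesis by (simp only:)
qed

lemma comp1_imp:
  assumes "comp1 (\<lambda>x. of_bool (P x))" "comp1 (\<lambda>x. of_bool (Q x))"
  shows "comp1 (\<lambda>x. of_bool (P x \<longrightarrow> Q x))"
proof -
  have "comp1 (\<lambda>x. if P x then of_bool (Q x) else 1)" by (intro comp1_if comp1_const assms)
  moreover have "(\<lambda>x. if P x then of_bool (Q x) else 1) = (\<lambda>x. of_bool (P x \<longrightarrow> Q x) :: nat)"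
    by (auto simp: fun_eq_iff)
  ultimately show ?thesis by (simp only:)
qed

lemma comp1_all_le:
  assumes "comp1 m" "comp1 (\<lambda>z. of_bool (P (pfst z) (psnd z)))"
  shows "comp1 (\<lambda>x. of_bool (\<forall>y\<le>m x. P y x))"
proof -
  have 1: "comp1 (\<lambda>z. of_bool (P (a z) (b z)))" if "comp1 a" "comp1 b" for a b
    using comp1_comp1 [OF assms(2) comp1_pair [OF that]] by simp
  \<comment> \<open>A flag starts at 1 and drops to 0 for good at the first failure;
    \<open>Suc (m x)\<close> steps are taken since the bound is inclusive.\<close>
  have 2: "comp1 (\<lambda>x. rec_nat 1 (\<lambda>y r. if P y x then r else 0) (Suc (m x)))"
    by (intro comp1_rec_nat comp1_if 1 comp1_arith comp1_const comp1_pfst comp1_psnd comp1_id assms)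
  have 3: "rec_nat 1 (\<lambda>y r. if P y x then r else 0) n = of_bool (\<forall>y<n. P y x)" for n x
    by (induction n) (auto simp: less_Suc_eq)
  show ?thesis using 2 unfolding 3 less_Suc_eq_le .
qed

text \<open>The recursion state pairs the accumulator with the code of the remaining list. Each step
  \<open>h\<close> consumes one entry and leaves the state unchanged once the list is empty, so
  \<open>l x\<close> steps suffice: a code is at least the length of its list.\<close>

lemma comp1_fold:
  assumes "comp1 l" "comp1 a" "comp1 (\<lambda>z. f (pfst z) (pfst (psnd z)) (psnd (psnd z)))"
  shows "comp1 (\<lambda>x. fold (\<lambda>i r. f i r x) (list_decode (l x)) (a x))"
proof -
  have 1: "comp1 (\<lambda>z. f (u z) (v z) (w z))" if "comp1 u" "comp1 v" "comp1 w" for u v w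
    using comp1_comp1 [OF assms(3) comp1_pair [OF that(1) comp1_pair [OF that(2,3)]]] by simp
  define h where "h x s = (if psnd s = 0 then s else
      prod_encode (f (pfst (psnd s - 1)) (pfst s) x, psnd (psnd s - 1)))" for x s
  have "comp1 (\<lambda>x. pfst (rec_nat (prod_encode (a x, l x)) (\<lambda>_ s. h x s) (l x)))"
    unfolding h_def
    by (intro comp1_pfst comp1_rec_nat comp1_if0 1 comp1_arith comp1_const comp1_psnd comp1_id
        comp1_pair assms)
  moreover have "pfst (rec_nat (prod_encode (a x, l x)) (\<lambda>_ s. h x s) (l x)) =
      fold (\<lambda>i r. f i r x) (list_decode (l x)) (a x)" for x
  proof -
    let ?l = "list_decode (l x)"
    have h: "h x (prod_encode (r, 0)) = prod_encode (r, 0)"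
      "h x (prod_encode (r, Suc (prod_encode (y, v)))) = prod_encode (f y r x, v)" for r y v
      by (simp_all add: h_def)
    have "rec_nat (prod_encode (a x, l x)) (\<lambda>_ s. h x s) n =
        prod_encode (fold (\<lambda>i r. f i r x) (take n ?l) (a x), list_encode (drop n ?l))" for n
    proof (induction n)
      case (Suc n)
      show ?case
      proof (cases "drop n ?l")
        case Nil
        then show ?thesis by (simp add: Suc h)
      next
        case (Cons y ys)
        then have "n < length ?l" "y = ?l ! n" "ys = drop (Suc n) ?l"
          by (metis drop_eq_Nil linorder_not_less list.discI, metis nth_via_drop, metis drop_Suc list.sel(3) tl_drop)
        then show ?thesis using Cons by (simp add: Suc h take_Suc_conv_app_nth)
      qed
    qed simp
    then show ?thesis by (simp add: length_list_decode_le)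
  qed
  ultimately show ?thesis by simp
qed

lemma comp1_foldr:
  assumes "comp1 l" "comp1 a" "comp1 (\<lambda>z. f (pfst z) (pfst (psnd z)) (psnd (psnd z)))"
  shows "comp1 (\<lambda>x. foldr (\<lambda>i r. f i r x) (list_decode (l x)) (a x))"
proof -
  \<comment> \<open>Folding the coded cons operation, starting from the code 0 of the empty list,
    reverses a coded list, and \<open>foldr\<close> is \<open>fold\<close> over the
    reversal.\<close>
  have "fold (\<lambda>i r. Suc (prod_encode (i, r))) xs (list_encode ys) = list_encode (rev xs @ ys)" for xs ys
    by (induction xs arbitrary: ys) (simp_all flip: list_encode.simps(2))
  from this [of _ "[]"] have "fold (\<lambda>i r. Suc (prod_encode (i, r))) xs 0 = list_encode (rev xs)" for xs
    by simp
  moreover have "comp1 (\<lambda>x. fold (\<lambda>i r. Suc (prod_encode (i, r))) (list_decode (l x)) 0)"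
    by (intro comp1_fold comp1_arith comp1_pair comp1_pfst comp1_psnd comp1_id comp1_const assms)
  ultimately have "comp1 (\<lambda>x. list_encode (rev (list_decode (l x))))" by simp
  from comp1_fold [OF this assms(2,3)] show ?thesis by (simp add: foldr_conv_fold)
qed

lemmas comp1_intros = comp1_id comp1_const comp1_arith comp1_pfst comp1_psnd comp1_pair
  comp1_if0 comp1_rec_nat

lemma comp1_parity:
  shows comp1_div2: "comp1 (\<lambda>n. n div 2)" and comp1_even: "comp1 (\<lambda>n. of_bool (even n))"
proof -
  \<comment> \<open>The halves of \<open>y\<close> and of \<open>Suc y\<close>, both rounded down,
    add up to \<open>y\<close>.\<close>
  have "comp1 (\<lambda>x. rec_nat 0 (\<lambda>y r. y - r) x)" by (intro comp1_intros)
  moreover have "rec_nat 0 (\<lambda>y r. y - r) x = x div 2" for x :: nat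
    by (induction x) auto
  ultimately show d: "comp1 (\<lambda>n. n div 2)" by simp
  have "comp1 (\<lambda>n. of_bool (n - 2 * (n div 2) = 0))" by (intro comp1_intros d comp1_eq0)
  moreover have "n - 2 * (n div 2) = 0 \<longleftrightarrow> even n" for n :: nat by presburger
  ultimately show "comp1 (\<lambda>n. of_bool (even n))" by simp
qed

end


interpretation prim_rec: function_class prim_rec_fn
  by unfold_locales (auto intro: prim_rec_fn.intros prim_rec_fn.succ [simplified])

interpretation recursive: function_class recursive_fn
  by unfold_locales (auto intro: recursive_fn.intros recursive_fn.succ [simplified])

section \<open>Extending homomorphisms to automorphisms\<close>

text \<open>
  A homomorphism defined on a subring is handled as its graph, a subring of the product.
\<close>

definition hom_graph :: "('a::idom \<times> 'a) set \<Rightarrow> bool" where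
  "hom_graph G \<longleftrightarrow> (1, 1) \<in> G \<and>
     (\<forall>x x' y y'. (x, x') \<in> G \<longrightarrow> (y, y') \<in> G \<longrightarrow> (x - y, x' - y') \<in> G \<and> (x * y, x' * y') \<in> G) \<and>
     (\<forall>b. (0, b) \<in> G \<longrightarrow> b = 0)"

text \<open>The polynomial \<open>p'\<close> is the image of \<open>p\<close> when the homomorphism
  with graph \<open>G\<close> is applied to the coefficients.\<close>

definition coeff_rel :: "('a::idom \<times> 'a) set \<Rightarrow> 'a poly \<Rightarrow> 'a poly \<Rightarrow> bool" where
  "coeff_rel G p p' \<longleftrightarrow> (\<forall>i. (coeff p i, coeff p' i) \<in> G)"

text \<open>The candidate for the extension that sends \<open>a\<close> to \<open>b\<close>. It is a
  relation for any \<open>a\<close> and \<open>b\<close>; single-valuedness is the issue in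
  \<open>hom_graph_adjoin\<close>.\<close>

definition adjoin :: "('a::idom \<times> 'a) set \<Rightarrow> 'a \<Rightarrow> 'a \<Rightarrow> ('a \<times> 'a) set" where
  "adjoin G a b = {(poly p a, poly p' b) | p p'. coeff_rel G p p'}"

lemma adjoinI: "coeff_rel G p p' \<Longrightarrow> (poly p a, poly p' b) \<in> adjoin G a b"
  unfolding adjoin_def by blast

context
  fixes G :: "('a::idom \<times> 'a) set"
  assumes G: "hom_graph G"
begin

lemma hom_graph_one: "(1, 1) \<in> G"
  and hom_graph_diff: "(x, x') \<in> G \<Longrightarrow> (y, y') \<in> G \<Longrightarrow> (x - y, x' - y') \<in> G"
  and hom_graph_mult: "(x, x') \<in> G \<Longrightarrow> (y, y') \<in> G \<Longrightarrow> (x * y, x' * y') \<in> G"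
  and hom_graph_zero_left: "(0, b) \<in> G \<Longrightarrow> b = 0"
  using G unfolding hom_graph_def by blast+

lemma hom_graph_zero: "(0, 0) \<in> G"
  using hom_graph_diff [OF hom_graph_one hom_graph_one] by simp

lemma hom_graph_add: "(x, x') \<in> G \<Longrightarrow> (y, y') \<in> G \<Longrightarrow> (x + y, x' + y') \<in> G"
  using hom_graph_diff [of x x' "0 - y" "0 - y'"] hom_graph_diff [OF hom_graph_zero, of y y'] by simp

lemma hom_graph_unique: "(x, b) \<in> G \<Longrightarrow> (x, c) \<in> G \<Longrightarrow> b = c"
  using hom_graph_diff [of x b x c] hom_graph_zero_left by fastforce

lemma hom_graph_sum:
  "(\<And>i. i \<in> A \<Longrightarrow> (f i, g i) \<in> G) \<Longrightarrow> (sum f A, sum g A) \<in> G"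
  by (induction A rule: infinite_finite_induct) (auto intro: hom_graph_zero hom_graph_add)

lemma hom_graph_power: "(x, y) \<in> G \<Longrightarrow> (x ^ k, y ^ k) \<in> G"
  by (induction k) (auto intro: hom_graph_one hom_graph_mult)

lemma hom_graph_Ints: "x \<in> \<int> \<Longrightarrow> (x, x) \<in> G"
proof (induction rule: Ints_induct)
  case (of_int z)
  have "(of_nat n, of_nat n) \<in> G" for n
    by (induction n) (auto intro: hom_graph_zero hom_graph_one hom_graph_add)
  then show ?case
    using hom_graph_diff [OF hom_graph_zero] by (cases z rule: int_cases2) force+
qed

lemma coeff_rel_diff: "coeff_rel G p p' \<Longrightarrow> coeff_rel G q q' \<Longrightarrow> coeff_rel G (p - q) (p' - q')"
  by (simp add: coeff_rel_def hom_graph_diff)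

lemma coeff_rel_add: "coeff_rel G p p' \<Longrightarrow> coeff_rel G q q' \<Longrightarrow> coeff_rel G (p + q) (p' + q')"
  by (simp add: coeff_rel_def hom_graph_add)

lemma coeff_rel_smult: "(c, c') \<in> G \<Longrightarrow> coeff_rel G p p' \<Longrightarrow> coeff_rel G (smult c p) (smult c' p')"
  by (simp add: coeff_rel_def hom_graph_mult)

lemma coeff_rel_mult: "coeff_rel G p p' \<Longrightarrow> coeff_rel G q q' \<Longrightarrow> coeff_rel G (p * q) (p' * q')"
  by (auto simp: coeff_rel_def coeff_mult intro!: hom_graph_sum hom_graph_mult)

lemma coeff_rel_monom: "(c, c') \<in> G \<Longrightarrow> coeff_rel G (monom c n) (monom c' n)"
  by (simp add: coeff_rel_def hom_graph_zero)

lemma coeff_rel_const: "(c, c') \<in> G \<Longrightarrow> coeff_rel G [:c:] [:c':]"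
  using coeff_rel_monom [of c c' 0] by (simp add: monom_0)

lemma coeff_rel_Ints: "\<forall>i. coeff p i \<in> \<int> \<Longrightarrow> coeff_rel G p p"
  by (simp add: coeff_rel_def hom_graph_Ints)

text \<open>Division by \<open>m\<close> is carried out simultaneously on both sides of
  \<open>G\<close>. The domain of \<open>G\<close> is only a ring, so the coefficient at
  \<open>d\<close> is multiplied in rather than inverted. Each round cancels the top coefficient of
  \<open>p\<close>. The degree condition is stated for the remainder on the left only.\<close>

lemma coeff_rel_pseudo_division:
  assumes m: "coeff_rel G m m'" "\<forall>i>d. coeff m i = 0"
    and p: "coeff_rel G p p'" "\<forall>i\<ge>n. coeff p i = 0"
  shows "\<exists>k q q' r r'. coeff_rel G q q' \<and> coeff_rel G r r' \<and> smult (coeff m d ^ k) p = q * m + r \<and>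
    smult (coeff m' d ^ k) p' = q' * m' + r' \<and> (\<forall>i\<ge>d. coeff r i = 0)"
  using p
proof (induction n arbitrary: p p')
  case 0
  then have "coeff_rel G 0 0 \<and> coeff_rel G p p' \<and> smult (coeff m d ^ 0) p = 0 * m + p \<and>
    smult (coeff m' d ^ 0) p' = 0 * m' + p' \<and> (\<forall>i\<ge>d. coeff p i = 0)"
    by (simp add: coeff_rel_def hom_graph_zero)
  then show ?case by blast
next
  case (Suc n)
  show ?case
  proof (cases "n < d")
    case True
    then have "coeff_rel G 0 0 \<and> coeff_rel G p p' \<and> smult (coeff m d ^ 0) p = 0 * m + p \<and>
        smult (coeff m' d ^ 0) p' = 0 * m' + p' \<and> (\<forall>i\<ge>d. coeff p i = 0)"
      using Suc.prems by (simp add: coeff_rel_def hom_graph_zero)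
    then show ?thesis by blast
  next
    case False
    define s where "s = monom (coeff p n) (n - d)"
    define s' where "s' = monom (coeff p' n) (n - d)"
    let ?c = "coeff m d" and ?c' = "coeff m' d"
    have c: "(?c, ?c') \<in> G" using m by (simp add: coeff_rel_def)
    have s: "coeff_rel G s s'"
      using Suc.prems unfolding s_def s'_def by (intro coeff_rel_monom) (simp add: coeff_rel_def)
    have "coeff_rel G (smult ?c p - s * m) (smult ?c' p' - s' * m')"
      by (intro coeff_rel_diff coeff_rel_smult coeff_rel_mult c s m Suc.prems)
    moreover have "coeff (smult ?c p - s * m) i = 0" if "i \<ge> n" for i
    proof (cases "i = n")
      case True
      with False show ?thesis by (simp add: s_def coeff_monom_mult)
    next
      case False
      with that have "i > n" by simp
      with \<open>\<not> n < d\<close> show ?thesis using Suc.prems m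
        by (simp add: s_def coeff_monom_mult)
    qed
    ultimately obtain k q q' r r' where IH: "coeff_rel G q q'" "coeff_rel G r r'"
      "smult (?c ^ k) (smult ?c p - s * m) = q * m + r"
      "smult (?c' ^ k) (smult ?c' p' - s' * m') = q' * m' + r'" "\<forall>i\<ge>d. coeff r i = 0"
      using Suc.IH by blast
    have "coeff_rel G (q + smult (?c ^ k) s) (q' + smult (?c' ^ k) s')"
      by (intro coeff_rel_add IH coeff_rel_smult hom_graph_power c s)
    moreover have "smult (?c ^ Suc k) p = (q + smult (?c ^ k) s) * m + r"
      "smult (?c' ^ Suc k) p' = (q' + smult (?c' ^ k) s') * m' + r'"
      using IH(3,4) by (simp_all add: smult_diff_right algebra_simps)
    ultimately show ?thesis using IH(2,5) by blast
  qed
qed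

lemma subset_adjoin: "G \<subseteq> adjoin G a b"
  unfolding adjoin_def using coeff_rel_const by (auto intro!: exI [of _ "[:_:]"])

lemma in_adjoin: "(a, b) \<in> adjoin G a b"
proof -
  have "coeff_rel G (monom 1 1) (monom 1 1)" by (intro coeff_rel_monom hom_graph_one)
  then show ?thesis unfolding adjoin_def by (force simp: poly_monom)
qed

text \<open>The hypothesis says that every relation satisfied by \<open>a\<close> is satisfied,
  after applying the homomorphism, by \<open>b\<close>; this is single-valuedness at 0.\<close>

lemma hom_graph_adjoin:
  assumes "\<And>p p'. coeff_rel G p p' \<Longrightarrow> poly p a = 0 \<Longrightarrow> poly p' b = 0"
  shows "hom_graph (adjoin G a b)"
proof -
  have "(1, 1) \<in> adjoin G a b" using subset_adjoin hom_graph_one by blast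
  moreover have "(x - y, x' - y') \<in> adjoin G a b \<and> (x * y, x' * y') \<in> adjoin G a b"
    if "(x, x') \<in> adjoin G a b" "(y, y') \<in> adjoin G a b" for x x' y y'
  proof -
    from that(1) obtain p p' where "coeff_rel G p p'" "x = poly p a" "x' = poly p' b"
      unfolding adjoin_def by blast
    moreover from that(2) obtain q q' where "coeff_rel G q q'" "y = poly q a" "y' = poly q' b"
      unfolding adjoin_def by blast
    ultimately show ?thesis
      using adjoinI [OF coeff_rel_diff, of p p' q q' a b] adjoinI [OF coeff_rel_mult, of p p' q q' a b]
      by simp
  qed
  moreover have "b' = 0" if "(0, b') \<in> adjoin G a b" for b'
    using that assms unfolding adjoin_def by force
  ultimately show ?thesis unfolding hom_graph_def by blast
qed

end

text \<open>A nonzero algebraic \<open>x\<close> is a root of an integer polynomial with nonzero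
  constant term. The homomorphism fixes integers, so if it sent \<open>x\<close> to 0, it would send
  the value 0 of the polynomial at \<open>x\<close> to that constant term.\<close>

lemma hom_graph_injective:
  fixes G :: "('a::field_char_0 \<times> 'a) set"
  assumes G: "hom_graph G" and "(x, 0) \<in> G" and "algebraic x"
  shows "x = 0"
proof (rule ccontr)
  assume "x \<noteq> 0"
  with assms obtain p where p: "coeff p 0 \<noteq> 0" "poly (map_poly of_int p) x = 0"
    using algebraicE'_nonzero by blast
  let ?p = "map_poly of_int p :: 'a poly"
  have c: "coeff ?p i = of_int (coeff p i)" for i by (simp add: coeff_map_poly)
  have "(poly ?p x, poly ?p 0) \<in> G"
    unfolding poly_altdef using assms
    by (intro hom_graph_sum hom_graph_mult hom_graph_power hom_graph_Ints) (auto simp: c)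
  then have "poly ?p 0 = 0" using hom_graph_zero_left [OF G] p by simp
  then show False using p by (simp add: poly_0_coeff_0 c)
qed

text \<open>Take \<open>m\<close> of least degree \<open>d\<close> over the domain of
  \<open>G\<close> that vanishes at \<open>a\<close>. By injectivity its image \<open>m'\<close>
  keeps a nonzero coefficient at \<open>d\<close>, so it has a root \<open>b\<close>. Any relation
  of \<open>a\<close> leaves remainder 0 under pseudo-division by \<open>m\<close>, hence its image
  vanishes at \<open>b\<close>.\<close>

lemma hom_graph_extend:
  fixes G :: "('a::{alg_closed_field, field_char_0} \<times> 'a) set"
  assumes alg: "\<forall>x::'a. algebraic x" and G: "hom_graph G"
  shows "\<exists>b. hom_graph (adjoin G a b)"
proof -
  define P where "P d \<longleftrightarrow> (\<exists>m m'. coeff_rel G m m' \<and> coeff m d \<noteq> 0 \<and> (\<forall>i>d. coeff m i = 0) \<and> poly m a = 0)" for d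
  obtain f where f: "\<And>i. coeff f i \<in> \<int>" "f \<noteq> 0" "poly f a = 0"
    using alg algebraicE by blast
  \<comment> \<open>Integer polynomials are related to themselves, so an integer equation for
    \<open>a\<close> shows that some degree occurs.\<close>
  then have "P (degree f)"
    unfolding P_def using coeff_rel_Ints [OF G] by (auto simp: coeff_eq_0 intro!: exI [of _ f])
  define d where "d = (LEAST d. P d)"
  have "P d" unfolding d_def using \<open>P (degree f)\<close> by (rule LeastI)
  then obtain m m' where m: "coeff_rel G m m'" "coeff m d \<noteq> 0" "\<forall>i>d. coeff m i = 0" "poly m a = 0"
    unfolding P_def by blast
  have least: "r = 0" if "coeff_rel G r r'" "poly r a = 0" "\<forall>i\<ge>d. coeff r i = 0" for r r'
  proof (rule ccontr)
    assume "r \<noteq> 0"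
    then have "P (degree r)" unfolding P_def using that by (auto simp: coeff_eq_0)
    then have "d \<le> degree r" unfolding d_def by (rule Least_le)
    with that \<open>r \<noteq> 0\<close> show False by auto
  qed
  have c: "(coeff m d, coeff m' d) \<in> G" using m by (simp add: coeff_rel_def)
  then have c': "coeff m' d \<noteq> 0" using hom_graph_injective [OF G] m(2) alg by metis
  have "degree m > 0"
  proof (rule ccontr)
    assume "\<not> degree m > 0"
    then obtain u where "m = [:u:]" by (auto elim: degree_eq_zeroE)
    with m show False by auto
  qed
  moreover have "degree m = d" using m by (metis le_degree le_antisym leI leading_coeff_0_iff coeff_0)
  ultimately have "d > 0" by simp
  with c' have "degree m' > 0" by (metis le_degree less_le_trans)
  then obtain b where b: "poly m' b = 0" using alg_closed_imp_poly_has_root by blast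
  have "poly p' b = 0" if p: "coeff_rel G p p'" "poly p a = 0" for p p'
  proof -
    have "\<forall>i\<ge>Suc (degree p). coeff p i = 0" by (simp add: coeff_eq_0)
    from coeff_rel_pseudo_division [OF G m(1,3) p(1) this]
    obtain k q q' r r' where *: "coeff_rel G q q'" "coeff_rel G r r'"
      "smult (coeff m d ^ k) p = q * m + r" "smult (coeff m' d ^ k) p' = q' * m' + r'"
      "\<forall>i\<ge>d. coeff r i = 0" by blast
    have "poly r a = 0" using arg_cong [OF *(3), of "\<lambda>p. poly p a"] m p by simp
    with * least have "r = 0" by blast
    then have "r' = 0" using *(2) hom_graph_zero_left [OF G] by (auto simp: coeff_rel_def poly_eq_iff)
    then show ?thesis using arg_cong [OF *(4), of "\<lambda>p. poly p b"] b c' by simp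
  qed
  then show ?thesis using hom_graph_adjoin [OF G] by blast
qed

text \<open>Zorn's lemma: a union of a chain of graphs is a graph, and a maximal one must contain
  each of its one-element extensions.\<close>

lemma hom_graph_extend_total:
  fixes G :: "('a::{alg_closed_field, field_char_0} \<times> 'a) set"
  assumes alg: "\<forall>x::'a. algebraic x" and G: "hom_graph G"
  shows "\<exists>H. hom_graph H \<and> G \<subseteq> H \<and> Domain H = UNIV"
proof -
  let ?A = "{H. hom_graph H \<and> G \<subseteq> H}"
  have "\<exists>H\<in>?A. \<forall>X\<in>?A. H \<subseteq> X \<longrightarrow> X = H"
  proof (rule subset_Zorn_nonempty)
    fix \<C> assume ne: "\<C> \<noteq> {}" and "subset.chain ?A \<C>"
    then have C: "\<And>H. H \<in> \<C> \<Longrightarrow> hom_graph H \<and> G \<subseteq> H"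
      "\<And>H K. H \<in> \<C> \<Longrightarrow> K \<in> \<C> \<Longrightarrow> H \<subseteq> K \<or> K \<subseteq> H"
      unfolding subset_chain_def by blast+
    have "hom_graph (\<Union>\<C>)" unfolding hom_graph_def
    proof (intro conjI allI impI)
      show "(1, 1) \<in> \<Union>\<C>" using ne C hom_graph_one by blast
      show "b = 0" if "(0, b) \<in> \<Union>\<C>" for b using that C hom_graph_zero_left by blast
      fix x x' y y' assume "(x, x') \<in> \<Union>\<C>" "(y, y') \<in> \<Union>\<C>"
      then obtain H where H: "H \<in> \<C>" "(x, x') \<in> H" "(y, y') \<in> H" using C(2) by blast
      then show "(x - y, x' - y') \<in> \<Union>\<C>" "(x * y, x' * y') \<in> \<Union>\<C>"
        using C(1) hom_graph_diff hom_graph_mult by blast+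
    qed
    then show "\<Union>\<C> \<in> ?A" using ne C by blast
  qed (use G in blast)
  then obtain H where "H \<in> ?A" and maximal: "\<forall>X\<in>?A. H \<subseteq> X \<longrightarrow> X = H" by (rule bexE)
  then have H: "hom_graph H" "G \<subseteq> H" by simp_all
  have max: "X = H" if "hom_graph X" "G \<subseteq> X" "H \<subseteq> X" for X
    using maximal that by simp
  have "a \<in> Domain H" for a
  proof -
    obtain b where "hom_graph (adjoin H a b)" using hom_graph_extend [OF alg H(1)] by blast
    then have "adjoin H a b = H"
      using max [OF _ order_trans [OF H(2)]] subset_adjoin [OF H(1)] by blast
    then have "(a, b) \<in> H" using in_adjoin [OF H(1), of a b] by simp
    then show ?thesis by (rule DomainI)
  qed
  with H show ?thesis by blast
qed

section \<open>Automorphisms of an algebraic field over the rationals\<close>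

lemma field_automorphism_simps:
  assumes "field_automorphism \<tau>"
  shows "bij \<tau>" "\<tau> 0 = 0" "\<tau> 1 = 1" "\<tau> (x + y) = \<tau> x + \<tau> y" "\<tau> (x * y) = \<tau> x * \<tau> y"
  using assms unfolding field_automorphism_def by auto

lemma poly_hom:
  fixes \<tau> :: "'a::comm_ring_1 \<Rightarrow> 'a"
  assumes \<tau>: "\<tau> 0 = 0" "\<tau> 1 = 1" "\<And>x y. \<tau> (x + y) = \<tau> x + \<tau> y" "\<And>x y. \<tau> (x * y) = \<tau> x * \<tau> y"
    and "\<forall>i. coeff p i \<in> \<int>"
  shows "poly p (\<tau> x) = \<tau> (poly p x)"
proof -
  have minus: "\<tau> (- y) = - \<tau> y" for y
    using \<tau>(1) \<tau>(3) [of y "- y"] by (simp add: eq_neg_iff_add_eq_0 add.commute)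
  have nat: "\<tau> (of_nat n) = of_nat n" for n by (induction n) (simp_all add: \<tau>)
  have int: "\<tau> y = y" if "y \<in> \<int>" for y
    using that by (induction rule: Ints_induct) (metis int_cases2 minus nat of_int_minus of_int_of_nat_eq)
  show ?thesis using assms(5)
  proof (induction p)
    case (pCons a p)
    have "coeff p i \<in> \<int>" for i using pCons.prems [rule_format, of "Suc i"] by simp
    moreover have "a \<in> \<int>" using pCons.prems [rule_format, of 0] by simp
    ultimately show ?case using pCons.IH by (simp add: \<tau> int)
  qed (simp add: \<tau>)
qed

lemma poly_automorphism:
  "field_automorphism \<tau> \<Longrightarrow> \<forall>i. coeff p i \<in> \<int> \<Longrightarrow> poly p (\<tau> x) = \<tau> (poly p x)"
  by (intro poly_hom) (auto simp: field_automorphism_simps)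

text \<open>Surjectivity comes from algebraicity: the map is injective and sends the finite root set
  of an integer polynomial of \<open>y\<close> into itself, so it permutes this set.\<close>

lemma field_automorphismI:
  fixes \<tau> :: "'a::field_char_0 \<Rightarrow> 'a"
  assumes alg: "\<forall>x::'a. algebraic x"
    and \<tau>: "\<tau> 0 = 0" "\<tau> 1 = 1" "\<And>x y. \<tau> (x + y) = \<tau> x + \<tau> y" "\<And>x y. \<tau> (x * y) = \<tau> x * \<tau> y"
  shows "field_automorphism \<tau>"
proof -
  have "inj \<tau>"
  proof (rule injI, rule ccontr)
    fix x y assume "\<tau> x = \<tau> y" "x \<noteq> y"
    then have "\<tau> (inverse (x - y) * (x - y)) = 1" using \<tau> by simp
    moreover have "\<tau> (x - y) + \<tau> y = \<tau> x" using \<tau>(3) [of "x - y" y] by simp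
    then have "\<tau> (x - y) = 0" using \<open>\<tau> x = \<tau> y\<close> by simp
    ultimately show False by (simp add: \<tau>)
  qed
  moreover have "y \<in> range \<tau>" for y
  proof -
    obtain p where p: "\<And>i. coeff p i \<in> \<int>" "p \<noteq> 0" "poly p y = 0" using alg algebraicE by blast
    let ?R = "{x. poly p x = 0}"
    have "\<tau> ` ?R \<subseteq> ?R" using poly_hom [of \<tau> p] \<tau> p by auto
    then have "\<tau> ` ?R = ?R" using poly_roots_finite [OF p(2)] \<open>inj \<tau>\<close>
      by (meson endo_inj_surj inj_on_subset subset_UNIV)
    with p show ?thesis by blast
  qed
  ultimately show ?thesis unfolding field_automorphism_def bij_def using \<tau> by auto
qed

lemma conjugate_automorphism:
  fixes a b :: "'a::{alg_closed_field, field_char_0}"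
  assumes alg: "\<forall>x::'a. algebraic x"
    and conj: "\<And>p :: 'a poly. \<forall>i. coeff p i \<in> \<int> \<Longrightarrow> poly p a = 0 \<Longrightarrow> poly p b = 0"
  shows "\<exists>\<sigma>. field_automorphism \<sigma> \<and> \<sigma> a = b"
proof -
  \<comment> \<open>The starting point is the identity on the integers. The hypothesis
    \<open>conj\<close> is what makes its extension by \<open>a\<close> and \<open>b\<close> well
    defined.\<close>
  define Z where "Z = {(x, x) | x::'a. x \<in> \<int>}"
  have Z: "hom_graph Z" unfolding hom_graph_def Z_def by auto
  have "coeff_rel Z p p' \<longleftrightarrow> p' = p \<and> (\<forall>i. coeff p i \<in> \<int>)" for p p'
    unfolding coeff_rel_def Z_def by (auto simp: poly_eq_iff)
  then have "hom_graph (adjoin Z a b)" using conj by (intro hom_graph_adjoin [OF Z]) auto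
  then obtain H where H: "hom_graph H" "adjoin Z a b \<subseteq> H" "Domain H = UNIV"
    using hom_graph_extend_total [OF alg] by blast
  define \<sigma> where "\<sigma> x = (THE y. (x, y) \<in> H)" for x
  have \<sigma>: "\<sigma> x = y" if "(x, y) \<in> H" for x y
    unfolding \<sigma>_def using that hom_graph_unique [OF H(1)] by blast
  have in_H: "(x, \<sigma> x) \<in> H" for x using H(3) \<sigma> by blast
  have "field_automorphism \<sigma>"
    by (intro field_automorphismI alg \<sigma> hom_graph_add hom_graph_mult hom_graph_one hom_graph_zero H in_H)
  moreover have "\<sigma> a = b" using in_adjoin [OF Z, of a b] H by (intro \<sigma>) auto
  ultimately show ?thesis by blast
qed

lemma field_automorphism_inv:
  assumes "field_automorphism \<sigma>"
  shows "field_automorphism (inv \<sigma>)"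
proof -
  have b: "bij \<sigma>" and s: "\<And>x. \<sigma> (inv \<sigma> x) = x" "\<And>x. inv \<sigma> (\<sigma> x) = x"
    using field_automorphism_simps(1) [OF assms] by (simp_all add: bij_is_surj surj_f_inv_f bij_is_inj)
  have "inv \<sigma> (x + y) = inv \<sigma> x + inv \<sigma> y" "inv \<sigma> (x * y) = inv \<sigma> x * inv \<sigma> y" for x y
    by (metis assms field_automorphism_simps(4) s, metis assms field_automorphism_simps(5) s)
  moreover have "inv \<sigma> 0 = 0" "inv \<sigma> 1 = 1"
    by (metis assms field_automorphism_simps(2) s(2), metis assms field_automorphism_simps(3) s(2))
  ultimately show ?thesis unfolding field_automorphism_def using bij_imp_bij_inv [OF b] by blast
qed

lemma is_subfield_vimage:
  assumes \<sigma>: "field_automorphism \<sigma>" and "is_subfield M"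
  shows "is_subfield (\<sigma> -` M)"
proof -
  note h = field_automorphism_simps [OF \<sigma>]
  have minus: "\<sigma> (- x) = - \<sigma> x" for x
    using h(4) [of x "- x"] by (simp add: h(2) eq_neg_iff_add_eq_0 add.commute)
  have "\<sigma> (inverse x) = inverse (\<sigma> x)" for x
  proof (cases "x = 0")
    case False
    then have "\<sigma> x * \<sigma> (inverse x) = 1" by (simp flip: h(5) add: h(3))
    then show ?thesis by (simp add: inverse_unique)
  qed (simp add: h)
  then show ?thesis using assms(2) minus unfolding is_subfield_def by (simp add: h)
qed

section \<open>Limits of automorphisms and simultaneous conjugation\<close>

text \<open>Compactness by a diagonal argument. The images of each element lie among the finitely
  many roots of one integer polynomial, so nested infinite index sets \<open>S k\<close> can be
  chosen such that the image of \<open>e k\<close> is constant on \<open>S (Suc k)\<close>. Every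
  field law concerns finitely many elements and passes from some \<open>\<tau> n\<close> to the
  limit.\<close>

lemma automorphism_limit:
  fixes e :: "nat \<Rightarrow> 'a::field_char_0" and \<tau> :: "nat \<Rightarrow> 'a \<Rightarrow> 'a"
  assumes alg: "\<forall>x::'a. algebraic x" and e: "range e = UNIV"
    and \<tau>: "\<And>n. field_automorphism (\<tau> n)"
  shows "\<exists>\<sigma>. field_automorphism \<sigma> \<and> (\<forall>F. finite F \<longrightarrow> infinite {n. \<forall>x\<in>F. \<tau> n x = \<sigma> x})"
proof -
  have orbit: "finite (range (\<lambda>n. \<tau> n x))" for x
  proof -
    obtain p where p: "\<And>i. coeff p i \<in> \<int>" "p \<noteq> 0" "poly p x = 0" using alg algebraicE by blast
    then have "range (\<lambda>n. \<tau> n x) \<subseteq> {x. poly p x = 0}"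
      using poly_automorphism [OF \<tau>] field_automorphism_simps(2) [OF \<tau>] by auto
    then show ?thesis using poly_roots_finite [OF p(2)] finite_subset by blast
  qed
  have "\<exists>S. \<forall>k. infinite (S k) \<and> (S (Suc k) \<subseteq> S k \<and> (\<exists>y. \<forall>n\<in>S (Suc k). \<tau> n (e k) = y))"
  proof (rule dependent_nat_choice [where P = "\<lambda>k S. infinite S"])
    show "\<exists>S::nat set. infinite S" by (rule exI [of _ UNIV]) simp
    fix S :: "nat set" and k assume "infinite S"
    moreover have "finite ((\<lambda>n. \<tau> n (e k)) ` S)" by (rule finite_subset [OF _ orbit [of "e k"]]) blast
    ultimately obtain m where "infinite {n\<in>S. \<tau> n (e k) = \<tau> m (e k)}"
      using pigeonhole_infinite by blast
    then show "\<exists>S'. infinite S' \<and> S' \<subseteq> S \<and> (\<exists>y. \<forall>n\<in>S'. \<tau> n (e k) = y)"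
      by (intro exI [of _ "{n\<in>S. \<tau> n (e k) = \<tau> m (e k)}"]) blast
  qed
  then obtain S where S: "\<And>k. infinite (S k)" "\<And>k. S (Suc k) \<subseteq> S k"
    "\<And>k. \<exists>y. \<forall>n\<in>S (Suc k). \<tau> n (e k) = y" by blast
  then obtain f where f: "\<And>k n. n \<in> S (Suc k) \<Longrightarrow> \<tau> n (e k) = f k" by metis
  have mono: "S l \<subseteq> S k" if "k \<le> l" for k l
    using S(2) that by (rule lift_Suc_antimono_le)
  \<comment> \<open>The sequence may repeat elements, so one index is chosen for each.\<close>
  obtain g where g: "\<And>x. e (g x) = x" using e by (metis surj_f_inv_f)
  define \<sigma> where "\<sigma> x = f (g x)" for x
  have lim: "infinite {n. \<forall>x\<in>F. \<tau> n x = \<sigma> x}" if "finite F" for F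
  proof -
    obtain k where k: "\<And>x. x \<in> F \<Longrightarrow> g x < k"
      using finite_nat_set_iff_bounded [THEN iffD1, OF finite_imageI [OF \<open>finite F\<close>], of g] by blast
    have "\<tau> n x = \<sigma> x" if "n \<in> S k" "x \<in> F" for n x
    proof -
      have "n \<in> S (Suc (g x))" using mono [of "Suc (g x)" k] k [OF that(2)] that(1) by auto
      from f [OF this] show ?thesis by (simp add: g \<sigma>_def)
    qed
    then have "S k \<subseteq> {n. \<forall>x\<in>F. \<tau> n x = \<sigma> x}" by blast
    with S(1) show ?thesis using infinite_super by blast
  qed
  have ex: "\<exists>n. \<forall>x\<in>F. \<tau> n x = \<sigma> x" if "finite F" for F
    using lim [OF that] not_finite_existsD by blast
  have "field_automorphism \<sigma>"
  proof (rule field_automorphismI [OF alg])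
    show "\<sigma> 0 = 0" "\<sigma> 1 = 1"
      using ex [of "{0}"] ex [of "{1}"] field_automorphism_simps [OF \<tau>] by auto
    show "\<sigma> (x + y) = \<sigma> x + \<sigma> y" for x y
      using ex [of "{x, y, x + y}"] field_automorphism_simps [OF \<tau>] by auto
    show "\<sigma> (x * y) = \<sigma> x * \<sigma> y" for x y
      using ex [of "{x, y, x * y}"] field_automorphism_simps [OF \<tau>] by auto
  qed
  with lim show ?thesis by blast
qed

section \<open>Interpolation in a subfield and simultaneous conjugation\<close>

lemma is_subfield_diff: "is_subfield K \<Longrightarrow> x \<in> K \<Longrightarrow> y \<in> K \<Longrightarrow> x - y \<in> K"
  unfolding is_subfield_def by (metis diff_conv_add_uminus)

lemma is_subfield_divide: "is_subfield K \<Longrightarrow> x \<in> K \<Longrightarrow> y \<in> K \<Longrightarrow> x / y \<in> K"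
  unfolding is_subfield_def by (metis divide_inverse)

lemma is_subfield_of_nat: "is_subfield K \<Longrightarrow> of_nat n \<in> K"
  by (induction n) (auto simp: is_subfield_def)

text \<open>Interpolation, by splitting off one node \<open>t0\<close> at a time: the quotient by
  \<open>X - t0\<close> takes the values (p(t) - p(t0)) / (t - t0) at the other nodes, and these lie
  in \<open>K\<close> again.\<close>

lemma coeffs_in_subfield_if_values:
  fixes K :: "'a::field set"
  assumes K: "is_subfield K"
    and "\<forall>i\<ge>n. coeff p i = 0" "finite S" "card S = n" "S \<subseteq> K" "\<And>t. t \<in> S \<Longrightarrow> poly p t \<in> K"
  shows "coeff p i \<in> K"
  using assms(2-)
proof (induction n arbitrary: p S i)
  case 0
  then show ?case using K by (simp add: is_subfield_def)
next
  case (Suc n)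
  then obtain t0 where t0: "t0 \<in> S" by fastforce
  define q where "q = synthetic_div p t0"
  have p: "p = [:- t0, 1:] * q + [:poly p t0:]"
    unfolding q_def by (rule synthetic_div_correct' [symmetric])
  have q0: "\<forall>i\<ge>n. coeff q i = 0"
  proof (cases "q = 0")
    case False
    then have "degree p \<noteq> 0" by (simp add: q_def synthetic_div_eq_0_iff)
    moreover have "degree p < Suc n"
      using Suc.prems(1) \<open>degree p \<noteq> 0\<close> by (metis degree_0 leI leading_coeff_0_iff)
    ultimately have "degree q < n" by (simp add: q_def degree_synthetic_div)
    then show ?thesis by (simp add: coeff_eq_0)
  qed simp
  have q: "coeff q j \<in> K" for j
  proof (rule Suc.IH [OF q0, of "S - {t0}"])
    fix t assume t: "t \<in> S - {t0}"
    have "poly p t = (t - t0) * poly q t + poly p t0"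
      using arg_cong [OF p, of "\<lambda>p. poly p t"] by (simp add: algebra_simps)
    then have "poly q t = (poly p t - poly p t0) / (t - t0)" using t by simp
    then show "poly q t \<in> K"
      using t t0 Suc.prems by (auto intro!: is_subfield_divide is_subfield_diff K)
  qed (use Suc.prems t0 in auto)
  have "coeff p i = (case i of 0 \<Rightarrow> poly p t0 | Suc j \<Rightarrow> coeff q j) - t0 * coeff q i"
    using arg_cong [OF p, of "\<lambda>p. coeff p i"] by (cases i) (simp_all add: algebra_simps)
  moreover have "t0 * coeff q i \<in> K" using q t0 Suc.prems K unfolding is_subfield_def by blast
  ultimately show ?case using q t0 Suc.prems K
    by (cases i) (auto intro!: is_subfield_diff)
qed

lemma card_listset_le:
  "(\<And>A. A \<in> set As \<Longrightarrow> finite A) \<Longrightarrow> finite (listset As) \<and> card (listset As) \<le> prod_list (map card As)"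
proof (induction As)
  case (Cons A As)
  have eq: "listset (A # As) = (\<lambda>(x, xs). x # xs) ` (A \<times> listset As)"
    by (auto simp: set_Cons_def)
  have "finite A" "finite (listset As)" "card (listset As) \<le> prod_list (map card As)"
    using Cons by simp_all
  then show ?case unfolding eq
    by (auto intro!: order_trans [OF card_image_le] simp: card_cartesian_product)
qed simp

lemma in_listset_map: "map f xs \<in> listset (map F xs)" if "\<And>x. x \<in> set xs \<Longrightarrow> f x \<in> F x"
  using that by (induction xs) (auto simp: set_Cons_def)

text \<open>
  The automorphisms moving the combinations \<open>a\<^sub>0 + t a\<^sub>1 + t\<^sup>2 a\<^sub>2 + \<dots>\<close> into \<open>M\<close> induce only finitely
  many different maps on the \<open>a\<^sub>j\<close>, so one of these maps serves enough values of \<open>t\<close> to solve for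
  the images of the \<open>a\<^sub>j\<close>.
\<close>
lemma simultaneous_automorphism:
  fixes a :: "nat \<Rightarrow> 'a::field_char_0" and p :: "nat \<Rightarrow> 'a poly"
  assumes M: "is_subfield M"
    and p: "\<And>i. p i \<noteq> 0" "\<And>i j. coeff (p i) j \<in> \<int>" "\<And>i. poly (p i) (a i) = 0"
    and N: "\<And>i. degree (p i) \<le> N i"
    and \<sigma>: "\<forall>t\<le>length is * prod_list (map N is). \<exists>\<sigma>. field_automorphism \<sigma> \<and>
      \<sigma> (foldr (\<lambda>i r. a i + of_nat t * r) is 0) \<in> M"
  shows "\<exists>\<sigma>. field_automorphism \<sigma> \<and> (\<forall>i\<in>set is. \<sigma> (a i) \<in> M)"
proof -
  let ?T = "{..length is * prod_list (map N is)}"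
  obtain s where s: "\<And>t. t \<in> ?T \<Longrightarrow> field_automorphism (s t)"
    "\<And>t. t \<in> ?T \<Longrightarrow> s t (foldr (\<lambda>i r. a i + of_nat t * r) is 0) \<in> M"
    using \<sigma> by (metis atMost_iff)
  define R where "R i = {x. poly (p i) x = 0}" for i
  \<comment> \<open>The tuple of images under the automorphism chosen for \<open>t\<close>; each
    component is a root of the corresponding \<open>p i\<close>.\<close>
  define h where "h t = map (\<lambda>i. s t (a i)) is" for t
  have R: "finite (R i)" "card (R i) \<le> N i" for i
    using poly_roots_finite [OF p(1)] card_poly_roots_bound [OF p(1)] N [of i]
    unfolding R_def by (auto intro: order_trans)
  have cardR: "prod_list (map (card \<circ> R) is) \<le> prod_list (map N is)"
    using R(2) by (induction "is") (auto intro: mult_le_mono)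
  have fin: "finite (listset (map R is))" "card (listset (map R is)) \<le> prod_list (map N is)"
    using card_listset_le [of "map R is"] R(1) order_trans [OF _ cardR] by auto
  have h: "h ` ?T \<subseteq> listset (map R is)"
  proof
    fix y assume "y \<in> h ` ?T"
    then obtain t where t: "t \<in> ?T" "y = h t" by blast
    then show "y \<in> listset (map R is)"
      unfolding t h_def R_def using p poly_automorphism [OF s(1) [OF t(1)]]
        field_automorphism_simps(2) [OF s(1) [OF t(1)]]
      by (intro in_listset_map) auto
  qed
  \<comment> \<open>Pigeonhole: there are at most \<open>prod_list (map N is)\<close> tuples, and
    the inclusive range of \<open>t\<close> has one value more than \<open>length is\<close> times
    this number.\<close>
  have "\<exists>y\<in>h ` ?T. length is < card {t\<in>?T. h t = y}"
  proof (rule ccontr)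
    assume "\<not> ?thesis"
    then have le: "card {t\<in>?T. h t = y} \<le> length is" if "y \<in> h ` ?T" for y
      using that by (meson not_less)
    have "card ?T \<le> card (\<Union>y\<in>h ` ?T. {t\<in>?T. h t = y})"
      by (intro card_mono) auto
    also have "\<dots> \<le> (\<Sum>y\<in>h ` ?T. card {t\<in>?T. h t = y})" by (intro card_UN_le) simp
    also have "\<dots> \<le> card (h ` ?T) * length is" using sum_bounded_above [OF le] by simp
    also have "\<dots> \<le> prod_list (map N is) * length is"
      using card_mono [OF fin(1) h] fin(2) by (intro mult_right_mono) auto
    finally show False by (simp add: mult.commute)
  qed
  then obtain t0 where t0: "t0 \<in> ?T" and card: "length is < card {t\<in>?T. h t = h t0}" by blast
  define q where "q = Poly (h t0)"
  obtain S where S: "S \<subseteq> {t\<in>?T. h t = h t0}" "card S = length is" "finite S"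
    using card by (metis (no_types, lifting) less_imp_le obtain_subset_with_card_n)
  \<comment> \<open>The automorphism for \<open>t\<close> maps the combination to the value at
    \<open>t\<close> of the polynomial whose coefficients are the images. For \<open>t\<close> in
    \<open>S\<close> these images agree with those for \<open>t0\<close>.\<close>
  have val: "poly q (of_nat t) \<in> M" if "t \<in> S" for t
  proof -
    have t: "t \<in> ?T" "h t = h t0" using that S by auto
    note hom = field_automorphism_simps [OF s(1) [OF t(1)]]
    have "s t (of_nat n) = of_nat n" for n by (induction n) (simp_all add: hom)
    then have "s t (foldr (\<lambda>i r. a i + of_nat t * r) js 0) = poly (Poly (map (\<lambda>i. s t (a i)) js)) (of_nat t)"
      for js by (induction js) (simp_all add: hom)
    moreover have "q = Poly (map (\<lambda>i. s t (a i)) is)"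
      unfolding q_def t(2) [symmetric] by (simp only: h_def)
    ultimately show ?thesis using s(2) [OF t(1)] by simp
  qed
  \<comment> \<open>The values lie in \<open>M\<close> at \<open>length is\<close> nodes, which are
    distinct in characteristic 0.\<close>
  have coeff: "coeff q i \<in> M" for i
  proof (rule coeffs_in_subfield_if_values [OF M])
    show "\<forall>i\<ge>length is. coeff q i = 0" by (simp add: q_def h_def nth_default_beyond)
    show "card (of_nat ` S :: 'a set) = length is" by (simp add: card_image S)
  qed (use S val in \<open>auto intro: is_subfield_of_nat [OF M]\<close>)
  have "s t0 (a i) \<in> M" if "i \<in> set is" for i
  proof -
    from that obtain j where "j < length is" "is ! j = i" by (auto simp: in_set_conv_nth)
    then have "coeff q j = s t0 (a i)" by (simp add: q_def h_def nth_default_nth)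
    with coeff show ?thesis by metis
  qed
  with s(1) [OF t0] show ?thesis by blast
qed

section \<open>Bounding minimal polynomials\<close>

lemma map_poly_of_int_hom:
  fixes p q :: "int poly"
  shows "map_poly of_int (p + q) = (map_poly of_int p + map_poly of_int q :: 'a::comm_ring_1 poly)"
    and "map_poly of_int (p * q) = (map_poly of_int p * map_poly of_int q :: 'a poly)"
    and "map_poly of_int (smult c p) = (smult (of_int c) (map_poly of_int p) :: 'a poly)"
  by (intro poly_eqI; simp add: coeff_map_poly coeff_mult)+

lemma coeff_map_poly_of_int [simp]: "coeff (map_poly of_int p) i = of_int (coeff p i)"
  by (simp add: coeff_map_poly)

text \<open>A Cauchy-type bound, with \<open>E\<close> bounding degree and coefficients alike. If z
  has norm above 1, the leading term has norm at least that of \<open>z ^ degree f\<close>, while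
  the fewer than \<open>Suc E\<close> lower terms contribute at most \<open>E\<close> times the next
  lower power each.\<close>

lemma poly_root_norm_bound:
  fixes f :: "int poly" and z :: complex
  assumes "f \<noteq> 0" "poly (map_poly of_int f) z = 0" "degree f \<le> E" "\<And>i. \<bar>coeff f i\<bar> \<le> int E"
  shows "norm z \<le> real E * real E"
proof -
  let ?d = "degree f"
  have lead: "\<bar>lead_coeff f\<bar> \<ge> 1" using assms(1) by (metis abs_ge_zero abs_0_eq leading_coeff_0_iff zless_imp_add1_zle add_0 order_le_imp_less_or_eq)
  then have E: "E \<ge> 1" using assms(4) [of ?d] by linarith
  then have E1: "1 \<le> real E * real E" by (simp add: mult_ge1_I)
  show ?thesis
  proof (cases "norm z \<le> 1")
    case False
    let ?c = "\<lambda>i. of_int (coeff f i) :: complex"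
    have deg: "degree (map_poly of_int f :: complex poly) = ?d" by (intro degree_map_poly) simp
    have sum: "(\<Sum>i<Suc ?d. ?c i * z ^ i) = 0"
      using assms(2) by (simp add: poly_altdef deg lessThan_Suc_atMost)
    have "?d > 0"
    proof (rule ccontr)
      assume "\<not> ?d > 0"
      then show False using sum lead by simp
    qed
    then have zd: "norm z ^ ?d = norm z * norm z ^ (?d - 1)" by (metis Suc_pred' power_Suc)
    have "norm z ^ ?d \<le> norm (?c ?d * z ^ ?d)"
      using lead by (simp add: norm_mult norm_power mult_le_cancel_right1 flip: of_int_abs)
    also have "\<dots> = norm (\<Sum>i<?d. ?c i * z ^ i)"
      using sum by (simp add: add_eq_0_iff)
    also have "\<dots> \<le> (\<Sum>i<?d. real E * norm z ^ (?d - 1))"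
    proof (rule sum_norm_le)
      fix i assume "i \<in> {..<?d}"
      then have "norm z ^ i \<le> norm z ^ (?d - 1)" using False by (intro power_increasing) auto
      moreover have "norm (?c i) \<le> real E" using assms(4) [of i] by simp
      ultimately show "norm (?c i * z ^ i) \<le> real E * norm z ^ (?d - 1)"
        by (simp add: norm_mult norm_power mult_mono)
    qed
    also have "\<dots> \<le> real E * (real E * norm z ^ (?d - 1))"
      using assms(3) by (simp add: mult_right_mono)
    finally have "norm z * norm z ^ (?d - 1) \<le> (real E * real E) * norm z ^ (?d - 1)"
      using zd by (simp add: mult.assoc)
    then show ?thesis by (rule mult_right_le_imp_le) (use False in \<open>intro zero_less_power, linarith\<close>)
  qed (use E1 in linarith)
qed

lemma norm_coeff_prod_linear_le:
  fixes A :: "complex multiset"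
  assumes "\<And>z. z \<in># A \<Longrightarrow> norm z \<le> R" "0 \<le> R"
  shows "norm (coeff (\<Prod>z\<in>#A. [:- z, 1:]) i) \<le> (1 + R) ^ size A"
  using assms(1)
proof (induction A arbitrary: i)
  case empty
  then show ?case by (cases i) simp_all
next
  case (add z A)
  let ?p = "\<Prod>z\<in>#A. [:- z, 1:]"
  have IH: "norm (coeff ?p i) \<le> (1 + R) ^ size A" for i using add by simp
  have z: "norm z \<le> R" using add by simp
  have "norm (coeff (pCons 0 ?p) i) \<le> (1 + R) ^ size A"
    using IH assms(2) by (cases i) auto
  moreover have "norm (z * coeff ?p i) \<le> R * (1 + R) ^ size A"
    using IH z assms(2) by (simp add: norm_mult mult_mono)
  \<comment> \<open>Multiplication by one more linear factor enlarges the coefficient bound by the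
    factor \<open>1 + R\<close>.\<close>
  ultimately have "norm (coeff (pCons 0 ?p) i - z * coeff ?p i) \<le> (1 + R) ^ size A + R * (1 + R) ^ size A"
    by (intro order_trans [OF norm_triangle_ineq4] add_mono)
  then show ?case by (simp add: algebra_simps)
qed

text \<open>The complex roots of \<open>g\<close> are roots of \<open>f\<close>, hence bounded, and
  the leading coefficient of \<open>g\<close> divides that of \<open>f\<close>. Expanding
  \<open>g\<close> into linear factors bounds all its coefficients.\<close>

lemma factor_coeff_bound:
  fixes f g :: "int poly"
  assumes f: "f \<noteq> 0" "g dvd f" "degree f \<le> E" "\<And>i. \<bar>coeff f i\<bar> \<le> int E"
  shows "\<bar>coeff g i\<bar> \<le> int (E * (1 + E * E) ^ E)"
proof -
  obtain h where h: "f = g * h" using f by blast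
  then have g0: "g \<noteq> 0" and deg: "degree g \<le> E"
    using f by (auto simp: degree_mult_eq)
  have "lead_coeff g dvd lead_coeff f" by (simp add: h lead_coeff_mult)
  then have lead: "\<bar>lead_coeff g\<bar> \<le> int E"
    using f dvd_imp_le_int [of "lead_coeff f" "lead_coeff g"] by (metis leading_coeff_0_iff order_trans)
  let ?g = "map_poly of_int g :: complex poly"
  have dg: "degree ?g = degree g" by (intro degree_map_poly) simp
  have "?g \<noteq> 0" using g0 by (metis coeff_map_poly_of_int leading_coeff_0_iff of_int_eq_0_iff coeff_0)
  then obtain A where A: "size A = degree g" "?g = smult (lead_coeff ?g) (\<Prod>x\<in>#A. [:- x, 1:])"
    using alg_closed_imp_factorization [of ?g] dg by metis
  have "norm z \<le> real E * real E" if "z \<in># A" for z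
  proof (rule poly_root_norm_bound [of f])
    have "poly ?g z = 0"
      using that by (subst A(2)) (auto simp: poly_prod_mset prod_mset_zero_iff image_iff)
    then show "poly (map_poly of_int f) z = 0" by (simp add: h map_poly_of_int_hom)
  qed (use f in auto)
  then have "norm (coeff (\<Prod>x\<in>#A. [:- x, 1:]) i) \<le> (1 + real E * real E) ^ degree g"
    using norm_coeff_prod_linear_le [of A "real E * real E"] A(1) by simp
  also have "\<dots> \<le> (1 + real E * real E) ^ E"
    using deg by (intro power_increasing) auto
  finally have b: "norm (coeff (\<Prod>x\<in>#A. [:- x, 1:]) i) \<le> (1 + real E * real E) ^ E" .
  have "real_of_int \<bar>coeff g i\<bar> = norm (coeff ?g i)" by simp
  also have "\<dots> = norm (lead_coeff ?g) * norm (coeff (\<Prod>x\<in>#A. [:- x, 1:]) i)"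
    by (subst A(2)) (simp add: norm_mult)
  also have "\<dots> \<le> real E * (1 + real E * real E) ^ E"
    using lead b by (intro mult_mono) (auto simp: dg simp flip: of_int_abs)
  also have "\<dots> = real_of_int (int (E * (1 + E * E) ^ E))" by simp
  finally show ?thesis by (simp only: of_int_le_iff)
qed

text \<open>The witness is the primitive part of a relation of least degree. Pseudo-remainders by it
  vanish by minimality, so each relation \<open>p\<close> has a nonzero integer multiple divisible
  by \<open>g\<close>. For \<open>f\<close> Gauss's lemma removes the multiplier, because
  \<open>g\<close> has content 1.\<close>

lemma minimal_integer_relation:
  fixes a :: "'a::field_char_0" and f :: "int poly"
  assumes f: "f \<noteq> 0" "poly (map_poly of_int f) a = 0"
  shows "\<exists>g. g dvd f \<and> poly (map_poly of_int g) a = 0 \<and>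
    (\<forall>p (x::'a). poly (map_poly of_int p) a = 0 \<longrightarrow> poly (map_poly of_int g) x = 0 \<longrightarrow>
      poly (map_poly of_int p) x = 0)"
proof -
  define P where "P p \<longleftrightarrow> p \<noteq> 0 \<and> poly (map_poly of_int p) a = 0" for p :: "int poly"
  have "P f" using f by (simp add: P_def)
  then obtain g0 where g0: "P g0" and min: "\<And>q. P q \<Longrightarrow> degree g0 \<le> degree q"
    using ex_has_least_nat [of P f degree] by blast
  define g where "g = primitive_part g0"
  have g0_eq: "g0 = smult (content g0) g" by (simp add: g_def)
  have g: "g \<noteq> 0" "content g = 1" "degree g = degree g0"
    using g0 by (auto simp: g_def P_def)
  have ga: "poly (map_poly of_int g) a = 0"
  proof -
    have "poly (map_poly of_int (smult (content g0) g)) a = 0"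
      using g0 g0_eq by (simp add: P_def)
    then show ?thesis using g0 by (simp add: map_poly_of_int_hom P_def)
  qed
  have div: "\<exists>c q. c \<noteq> 0 \<and> smult c p = g * q" if p: "poly (map_poly of_int p) a = 0" for p
  proof -
    obtain c q where cq: "c \<noteq> 0" "smult c p = g * q + pseudo_mod p g"
      using pseudo_mod(1) [OF g(1)] by blast
    have "poly (map_poly of_int (smult c p)) a = (0::'a)" using p by (simp add: map_poly_of_int_hom)
    then have "poly (map_poly of_int (pseudo_mod p g)) a = 0"
      unfolding cq(2) using ga by (simp add: map_poly_of_int_hom)
    then have "pseudo_mod p g = 0"
      using pseudo_mod(2) [OF g(1), of p] min [of "pseudo_mod p g"] g(3) unfolding P_def by fastforce
    with cq show ?thesis by auto
  qed
  have "g dvd f"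
  proof -
    obtain c q where cq: "c \<noteq> 0" "smult c f = g * q" using div f(2) by blast
    have "content q = \<bar>c\<bar> * content f"
      using arg_cong [OF cq(2), of content] by (simp add: content_mult g)
    then have "\<bar>c\<bar> dvd content q" by simp
    then have "[:c:] dvd q" by (simp add: const_poly_dvd_iff_dvd_content)
    then obtain q' where "q = [:c:] * q'" by blast
    then have "smult c f = smult c (g * q')" using cq by simp
    then have "f = g * q'" using cq(1) by (metis smult_cancel)
    then show ?thesis by simp
  qed
  moreover have "poly (map_poly of_int p) x = 0"
    if "poly (map_poly of_int p) a = 0" "poly (map_poly of_int g) x = 0" for p and x :: 'a
  proof -
    obtain c q where cq: "c \<noteq> 0" "smult c p = g * q" using div \<open>poly (map_poly of_int p) a = 0\<close> by blast
    have "of_int c * poly (map_poly of_int p) x = poly (map_poly of_int (smult c p)) x"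
      by (simp add: map_poly_of_int_hom)
    also have "\<dots> = 0" unfolding cq(2) using that by (simp add: map_poly_of_int_hom)
    finally show ?thesis using cq(1) by simp
  qed
  ultimately show ?thesis using ga by blast
qed

section \<open>Bounded codes of minimal relations\<close>

lemma prod_encode_mono: "a \<le> c \<Longrightarrow> b \<le> d \<Longrightarrow> prod_encode (a, b) \<le> prod_encode (c, d)"
proof -
  assume le: "a \<le> c" "b \<le> d"
  have "triangle (a + b) \<le> triangle (c + d)"
    using add_mono [OF le] by (rule lift_Suc_mono_le [of triangle, rotated]) simp
  with le show ?thesis by (simp add: prod_encode_def)
qed

text \<open>The right-hand side is the code of the list consisting of \<open>n\<close> copies of
  \<open>v\<close>.\<close>

lemma list_encode_le:
  "length xs \<le> n \<Longrightarrow> \<forall>x\<in>set xs. x \<le> v \<Longrightarrow> list_encode xs \<le> rec_nat 0 (\<lambda>_ r. Suc (prod_encode (v, r))) n"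
proof (induction xs arbitrary: n)
  case (Cons x xs)
  then show ?case by (cases n) (auto intro: prod_encode_mono)
qed simp

lemma abs_int_decode_le: "\<bar>int_decode k\<bar> \<le> int k"
  by (auto simp: int_decode_def sum_decode_def elim!: oddE evenE)

lemma int_encode_le: "int_encode z \<le> 2 * nat \<bar>z\<bar>"
  by (auto simp: int_encode_def sum_encode_def)

definition int_poly_of :: "nat \<Rightarrow> int poly" where
  "int_poly_of c = Poly (map int_decode (list_decode c))"

lemma int_index_poly_eq: "int_index_poly c = map_poly of_int (int_poly_of c)"
  by (rule poly_eqI) (simp add: int_index_poly_def int_poly_of_def nth_default_def)

lemma coeff_int_index_poly_Ints: "coeff (int_index_poly c) i \<in> \<int>"
  by (simp add: int_index_poly_eq)

lemma degree_int_poly_of_less: "int_poly_of c \<noteq> 0 \<Longrightarrow> degree (int_poly_of c) < c"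
proof -
  assume "int_poly_of c \<noteq> 0"
  then have "coeff (int_poly_of c) (degree (int_poly_of c)) \<noteq> 0" by simp
  then have "degree (int_poly_of c) < length (list_decode c)"
    unfolding int_poly_of_def by (auto simp: nth_default_def split: if_splits)
  then show ?thesis using length_list_decode_le [of c] by simp
qed

lemma coeff_int_poly_of_le: "\<bar>coeff (int_poly_of c) i\<bar> \<le> int c"
proof (cases "i < length (list_decode c)")
  case True
  then have "coeff (int_poly_of c) i = int_decode (list_decode c ! i)"
    by (simp add: int_poly_of_def nth_default_nth)
  moreover have "list_decode c ! i \<le> c" using True by (intro set_list_decode_le nth_mem)
  ultimately show ?thesis using abs_int_decode_le [of "list_decode c ! i"] by simp
qed (simp add: int_poly_of_def nth_default_beyond)

text \<open>The code of \<open>c\<close> copies of twice the bound of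
  \<open>factor_coeff_bound\<close> with \<open>E = c\<close>. The factor 2 accounts for
  \<open>int_encode\<close>.\<close>

definition code_bound :: "nat \<Rightarrow> nat" where
  "code_bound c = rec_nat 0 (\<lambda>_ r. Suc (prod_encode (2 * (c * (1 + c * c) ^ c), r))) c"

text \<open>A code dominates the degree and the coefficients of its polynomial, so
  \<open>factor_coeff_bound\<close> applies with \<open>E = c\<close> to the minimal relation
  dividing it.\<close>

lemma minimal_relation_code:
  fixes a :: "'a::field_char_0"
  assumes "int_index_poly c \<noteq> (0 :: 'a poly)" "poly (int_index_poly c) a = 0"
  shows "\<exists>d\<le>code_bound c. poly (int_index_poly d) a = 0 \<and>
    (\<forall>p x. (\<forall>i. coeff p i \<in> \<int>) \<longrightarrow> poly p a = 0 \<longrightarrow> poly (int_index_poly d) x = 0 \<longrightarrow> poly p x = 0)"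
proof -
  let ?f = "int_poly_of c"
  have f: "?f \<noteq> 0" using assms(1) by (auto simp: int_index_poly_eq)
  obtain g where g: "g dvd ?f" "poly (map_poly of_int g) a = 0"
    "\<And>p (x::'a). poly (map_poly of_int p) a = 0 \<Longrightarrow> poly (map_poly of_int g) x = 0 \<Longrightarrow> poly (map_poly of_int p) x = 0"
    using minimal_integer_relation [OF f, of a] assms(2) by (auto simp: int_index_poly_eq)
  define d where "d = list_encode (map int_encode (coeffs g))"
  have "degree g < c"
    using degree_int_poly_of_less [OF f] dvd_imp_degree_le [OF g(1) f] by simp
  then have "length (coeffs g) \<le> c" by (cases "g = 0") (simp_all add: length_coeffs_degree)
  moreover have "int_encode z \<le> 2 * (c * (1 + c * c) ^ c)" if "z \<in> set (coeffs g)" for z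
  proof -
    from that obtain i where "z = coeff g i" using range_coeff [of g] by blast
    then have "\<bar>z\<bar> \<le> int (c * (1 + c * c) ^ c)"
      using factor_coeff_bound [OF f g(1), of c] degree_int_poly_of_less [OF f] coeff_int_poly_of_le [of c]
      by simp
    with int_encode_le [of z] show ?thesis by linarith
  qed
  ultimately have "d \<le> code_bound c"
    unfolding d_def code_bound_def by (intro list_encode_le) auto
  moreover have "int_poly_of d = g" by (simp add: d_def int_poly_of_def comp_def)
  then have "int_index_poly d = (map_poly of_int g :: 'a poly)" by (simp add: int_index_poly_eq)
  moreover have "poly p x = 0"
    if "\<forall>i. coeff p i \<in> \<int>" "poly p a = 0" "poly (map_poly of_int g) x = 0" for p and x :: 'a
  proof -
    obtain q where "p = map_poly of_int q" using \<open>\<forall>i. coeff p i \<in> \<int>\<close> intpolyE by blast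
    with that g(3) show ?thesis by simp
  qed
  ultimately show ?thesis using g(2) by auto
qed

text \<open>Testing all \<open>d\<close> up to the bound avoids having to identify the minimal
  relation: it is among them, and a root of it in \<open>M\<close> is conjugate to \<open>a\<close>.
  Conversely, an automorphism maps roots of integer polynomials to roots.\<close>

lemma automorphism_into_iff:
  fixes a :: "'a::{alg_closed_field, field_char_0}"
  assumes alg: "\<forall>x::'a. algebraic x"
    and "int_index_poly c \<noteq> (0 :: 'a poly)" "poly (int_index_poly c) a = 0"
  shows "(\<exists>\<sigma>. field_automorphism \<sigma> \<and> \<sigma> a \<in> M) \<longleftrightarrow>
    (\<forall>d\<le>code_bound c. poly (int_index_poly d) a = 0 \<longrightarrow> (\<exists>x\<in>M. poly (int_index_poly d) x = 0))"
    (is "?L \<longleftrightarrow> ?R")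
proof
  assume ?L
  then obtain \<sigma> where \<sigma>: "field_automorphism \<sigma>" "\<sigma> a \<in> M" by blast
  then show ?R
    using poly_automorphism [OF \<sigma>(1)] coeff_int_index_poly_Ints field_automorphism_simps(2) [OF \<sigma>(1)]
    by (metis (no_types, lifting))
next
  assume R: ?R
  obtain d where d: "d \<le> code_bound c" "poly (int_index_poly d) a = 0"
    "\<And>p x. (\<forall>i. coeff p i \<in> \<int>) \<Longrightarrow> poly p a = 0 \<Longrightarrow> poly (int_index_poly d) x = 0 \<Longrightarrow> poly p x = 0"
    using minimal_relation_code [OF assms(2,3)] by blast
  then obtain x where x: "x \<in> M" "poly (int_index_poly d) x = 0" using R by blast
  have "\<exists>\<sigma>. field_automorphism \<sigma> \<and> \<sigma> a = x"
    using d(3) x(2) by (intro conjugate_automorphism [OF alg])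
  with x(1) show ?L by blast
qed

text \<open>Reduces tuples to single combinations. The code \<open>eqn i\<close> itself serves as
  the degree bound for \<open>e i\<close>, which makes the range of \<open>t\<close>
  computable.\<close>

lemma simultaneous_automorphism_iff:
  fixes e :: "nat \<Rightarrow> 'a::{alg_closed_field, field_char_0}"
  assumes alg: "\<forall>x::'a. algebraic x" and M: "is_subfield M"
    and eqn: "\<And>i. int_index_poly (eqn i) \<noteq> (0 :: 'a poly)" "\<And>i. poly (int_index_poly (eqn i)) (e i) = 0"
    and comb: "\<And>t is. e (comb t is) = foldr (\<lambda>i r. e i + of_nat t * r) is 0"
  shows "(\<exists>\<sigma>. field_automorphism \<sigma> \<and> (\<forall>i\<in>set is. \<sigma> (e i) \<in> M)) \<longleftrightarrow>
    (\<forall>t\<le>length is * prod_list (map eqn is). \<forall>d\<le>code_bound (eqn (comb t is)).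
      poly (int_index_poly d) (e (comb t is)) = 0 \<longrightarrow> (\<exists>x\<in>M. poly (int_index_poly d) x = 0))"
    (is "?L \<longleftrightarrow> ?R")
proof
  assume ?L
  then obtain \<sigma> where \<sigma>: "field_automorphism \<sigma>" "\<forall>i\<in>set is. \<sigma> (e i) \<in> M" by blast
  note hom = field_automorphism_simps [OF \<sigma>(1)]
  have nat: "\<sigma> (of_nat n) = of_nat n" for n by (induction n) (simp_all add: hom)
  have "\<sigma> (foldr (\<lambda>i r. e i + of_nat t * r) js 0) \<in> M" if "set js \<subseteq> set is" for t js
    using that
  proof (induction js)
    case (Cons j js)
    then have "\<sigma> (e j) \<in> M" "\<sigma> (foldr (\<lambda>i r. e i + of_nat t * r) js 0) \<in> M" using \<sigma>(2) by auto
    then show ?case using M is_subfield_of_nat [OF M, of t] unfolding is_subfield_def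
      by (simp add: hom nat)
  qed (use M in \<open>simp add: hom is_subfield_def\<close>)
  then have "\<exists>\<sigma>. field_automorphism \<sigma> \<and> \<sigma> (e (comb t is)) \<in> M" for t
    using \<sigma>(1) by (auto simp: comb)
  then show ?R using automorphism_into_iff [OF alg eqn, of _ M] by blast
next
  assume ?R
  then have "\<exists>\<sigma>. field_automorphism \<sigma> \<and> \<sigma> (e (comb t is)) \<in> M"
    if "t \<le> length is * prod_list (map eqn is)" for t
    using that automorphism_into_iff [OF alg eqn, of _ M] by blast
  moreover have "degree (int_index_poly (eqn i) :: 'a poly) \<le> eqn i" for i
  proof -
    have "int_poly_of (eqn i) \<noteq> 0" using eqn(1) [of i] by (auto simp: int_index_poly_eq)
    moreover have "degree (int_index_poly (eqn i) :: 'a poly) \<le> degree (int_poly_of (eqn i))"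
      unfolding int_index_poly_eq by (rule map_poly_degree_leq)
    ultimately show ?thesis using degree_int_poly_of_less [of "eqn i"] by linarith
  qed
  ultimately show ?L
    by (intro simultaneous_automorphism [where p = "\<lambda>i. int_index_poly (eqn i)" and N = eqn] M eqn
        coeff_int_index_poly_Ints) (auto simp: comb)
qed

section \<open>Deciding the conjugate subfield\<close>

text \<open>Horner form, so that the encoding is a \<open>foldr\<close> over the coefficient
  codes.\<close>

definition root_term :: "nat list \<Rightarrow> rterm" where
  "root_term ks = foldr (\<lambda>k t. TAdd (TConst (of_int (int_decode k))) (TMul (TVar 0) t)) ks (TConst 0)"

definition root_sentence :: "nat \<Rightarrow> ex_form" where
  "root_sentence c = Exists 1 (FEq (root_term (list_decode c)) (TConst 0))"

lemma root_sentence_in_Ex_theory_iff: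
  fixes M :: "'a::field_char_0 set"
  shows "sentence_encode (root_sentence c) \<in> sentence_encode ` Ex_theory M \<longleftrightarrow>
    (\<exists>x\<in>M. poly (int_index_poly c) x = 0)"
proof -
  have vars: "term_vars (root_term ks) \<subseteq> {..<1}" for ks
    by (induction ks) (auto simp: root_term_def)
  have val: "term_val v (root_term ks) = poly (Poly (map (\<lambda>k. of_int (int_decode k)) ks)) (v 0)"
    for v :: "nat \<Rightarrow> 'a" and ks by (induction ks) (simp_all add: root_term_def)
  have "root_sentence c \<in> Ex_theory M \<longleftrightarrow> (\<exists>v::nat \<Rightarrow> 'a. v 0 \<in> M \<and> poly (int_index_poly c) (v 0) = 0)"
    using vars by (simp add: Ex_theory_def root_sentence_def val int_index_poly_def)
  also have "\<dots> \<longleftrightarrow> (\<exists>x\<in>M. poly (int_index_poly c) x = 0)"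
  proof
    assume "\<exists>x\<in>M. poly (int_index_poly c) x = 0"
    then obtain x where "x \<in> M" "poly (int_index_poly c) x = 0" by blast
    then show "\<exists>v::nat \<Rightarrow> 'a. v 0 \<in> M \<and> poly (int_index_poly c) (v 0) = 0"
      by (intro exI [of _ "\<lambda>_. x"]) simp
  qed blast
  finally show ?thesis by (simp add: inj_image_mem_iff [OF inj_sentence_encode])
qed

text \<open>Exhibits the sentence code as a fold of pairings. The entry \<open>k\<close> already is
  the code of its integer, and the 1 next to it is the denominator.\<close>

lemma sentence_encode_root_sentence:
  "sentence_encode (root_sentence c) = prod_encode (1, prod_encode (0, prod_encode
     (foldr (\<lambda>k r. prod_encode (3, prod_encode (prod_encode (1, prod_encode (k, 1)),
        prod_encode (4, prod_encode (prod_encode (0, 0), r)))))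
      (list_decode c) (prod_encode (1, rat_encode 0)), prod_encode (1, rat_encode 0))))"
proof -
  have "rat_encode (of_int a) = prod_encode (int_encode a, 1)" for a
    by (simp add: rat_encode_def)
  then have "term_encode (root_term ks) =
    foldr (\<lambda>k r. prod_encode (3, prod_encode (prod_encode (1, prod_encode (k, 1)),
        prod_encode (4, prod_encode (prod_encode (0, 0), r))))) ks (prod_encode (1, rat_encode 0))" for ks
    by (induction ks) (simp_all add: root_term_def)
  then show ?thesis by (simp add: root_sentence_def)
qed

section \<open>Computability of the decision procedure\<close>

context function_class
begin

lemma comp1_code_bound: "comp1 a \<Longrightarrow> comp1 (\<lambda>x. code_bound (a x))"
proof (rule comp1_comp1 [of code_bound])
  have pow: "rec_nat 1 (\<lambda>_ r. (1 + c * c) * r) n = (1 + c * c) ^ n" for c n :: nat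
    by (induction n) simp_all
  have "comp1 (\<lambda>c. rec_nat 0 (\<lambda>_ r. Suc (prod_encode
      (2 * (c * rec_nat 1 (\<lambda>_ r. (1 + c * c) * r) c), r))) c)"
    by (intro comp1_intros)
  then show "comp1 code_bound" unfolding pow code_bound_def .
qed

lemma comp1_root_sentence: "comp1 (\<lambda>c. sentence_encode (root_sentence c))"
  unfolding sentence_encode_root_sentence by (intro comp1_intros comp1_foldr)

text \<open>Indices are not unique, so being zero has to be read off from a factorization:
  \<open>[:1, e i:]\<close> is a unit exactly if \<open>e i = 0\<close>, and only then is its list
  of irreducible factors empty, with code 0.\<close>

lemma zero_test:
  fixes e :: "nat \<Rightarrow> 'a::field"
  assumes fac: "\<And>c. index_poly e c \<noteq> 0 \<Longrightarrow>
       (let fs = map (index_poly e) (list_decode (fac c)) in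
          (\<forall>f\<in>set fs. irreducible f \<and> lead_coeff f = 1) \<and>
          index_poly e c = smult (lead_coeff (index_poly e c)) (prod_list fs))"
    and one: "e one = 1"
  shows "fac (list_encode [one, i]) = 0 \<longleftrightarrow> e i = 0"
proof -
  define c where "c = list_encode [one, i]"
  have p: "index_poly e c = [:1, e i:]"
    using one by (simp add: index_poly_def c_def del: list_encode.simps)
  define fs where "fs = map (index_poly e) (list_decode (fac c))"
  have fs: "\<And>f. f \<in> set fs \<Longrightarrow> irreducible f" "[:1, e i:] = smult (lead_coeff [:1, e i:]) (prod_list fs)"
    using fac [of c] unfolding p Let_def fs_def by auto
  have "fac c = 0 \<longleftrightarrow> fs = []" unfolding fs_def
    by (metis list_decode.simps(1) list_decode_inverse list_encode.simps(1) map_is_Nil_conv)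
  also have "\<dots> \<longleftrightarrow> e i = 0"
  proof
    assume "fs = []"
    then have "degree [:1, e i:] = 0" by (subst fs(2)) simp
    then show "e i = 0" by (simp split: if_splits)
  next
    assume "e i = 0"
    then have "prod_list fs = 1" using fs(2) by (simp add: one_pCons)
    show "fs = []"
    proof (cases fs)
      case (Cons f gs)
      then have "f dvd 1" using \<open>prod_list fs = 1\<close> 
        using dvd_triv_left [of f "prod_list gs"] by simp
      then show ?thesis using fs(1) [of f] Cons by (simp add: irreducible_def)
    qed
  qed
  finally show ?thesis unfolding c_def .
qed

text \<open>The right-hand side of \<open>simultaneous_automorphism_iff\<close> is computed on
  indices; its quantifiers are bounded and its two atomic conditions are decided by
  \<open>zero_test\<close> and by \<open>Ex\<close>.\<close>

lemma computable_simultaneous_automorphism: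
  fixes e :: "nat \<Rightarrow> 'a::{alg_closed_field, field_char_0}"
  assumes alg: "\<forall>x::'a. algebraic x" and e: "standard_presentation e" and M: "is_subfield M"
    and Ex: "comp1 (\<lambda>c. of_bool (c \<in> sentence_encode ` Ex_theory M))"
  shows "comp1 (\<lambda>s. of_bool (\<exists>\<sigma>. field_automorphism \<sigma> \<and> (\<forall>i\<in>set (list_decode s). \<sigma> (e i) \<in> M)))"
proof -
  obtain eqn add mul fac where surj: "range e = UNIV"
    and eqn_comp: "comp1 eqn"
    and eqn: "\<And>i. int_index_poly (eqn i) \<noteq> (0 :: 'a poly)" "\<And>i. poly (int_index_poly (eqn i)) (e i) = 0"
    and add_comp: "comp2 add" and add: "\<And>i j. e (add i j) = e i + e j"
    and mul_comp: "comp2 mul" and mul: "\<And>i j. e (mul i j) = e i * e j"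
    and fac_comp: "comp1 fac"
    and fac: "\<And>c. index_poly e c \<noteq> 0 \<Longrightarrow>
       (let fs = map (index_poly e) (list_decode (fac c)) in
          (\<forall>f\<in>set fs. irreducible f \<and> lead_coeff f = 1) \<and>
          index_poly e c = smult (lead_coeff (index_poly e c)) (prod_list fs))"
    using e unfolding standard_presentation_def by (metis prim_rec1_imp prim_rec2_imp)
  obtain zero one mone where const_index: "e zero = 0" "e one = 1" "e mone = - 1"
    using surj by (metis surjD)
  note I = comp1_intros comp1_comp1 [OF eqn_comp] comp1_comp2 [OF add_comp] comp1_comp2 [OF mul_comp]
    comp1_comp1 [OF fac_comp]

  define nat_index where "nat_index n = rec_nat zero (\<lambda>_ r. add one r) n" for n
  have nat_index: "e (nat_index n) = of_nat n" for n
    by (induction n) (simp_all add: nat_index_def const_index add)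
  have "comp1 nat_index" unfolding nat_index_def by (intro I)
  note I = I comp1_comp1 [OF this]

  \<comment> \<open>Even codes stand for nonnegative integers, and an odd code \<open>k\<close> for
    the negative of \<open>Suc (k div 2)\<close>. Negation is multiplication by a fixed index of
    -1.\<close>
  define int_index where "int_index k =
    (if even k then nat_index (k div 2) else mul mone (nat_index (Suc (k div 2))))" for k
  have int_index: "e (int_index k) = of_int (int_decode k)" for k
    by (simp add: int_index_def nat_index mul const_index int_decode_def sum_decode_def)
  have "comp1 int_index" unfolding int_index_def
    by (intro comp1_if comp1_even comp1_comp1 [OF comp1_div2] I)
  note I = I comp1_comp1 [OF this]

  define comb where "comb t is = foldr (\<lambda>i r. add i (mul (nat_index t) r)) is zero" for t "is"
  have comb: "e (comb t is) = foldr (\<lambda>i r. e i + of_nat t * r) is 0" for t "is"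
    by (induction "is") (simp_all add: comb_def add mul nat_index const_index)
  have comb_comp: "comp1 (\<lambda>x. comb (a x) (list_decode (b x)))" if "comp1 a" "comp1 b" for a b
    unfolding comb_def by (intro comp1_foldr I that comp1_comp1 [OF that(1)])

  \<comment> \<open>Horner evaluation on indices, matching \<open>int_index_poly\<close>.\<close>
  define val where "val d i = foldr (\<lambda>k r. add (int_index k) (mul i r)) (list_decode d) zero" for d i
  have val: "e (val d i) = poly (int_index_poly d) (e i)" for d i
  proof -
    have "e (foldr (\<lambda>k r. add (int_index k) (mul i r)) ks zero) =
      poly (Poly (map (\<lambda>k. of_int (int_decode k)) ks)) (e i)" for ks
      by (induction ks) (simp_all add: add mul int_index const_index)
    then show ?thesis by (simp add: val_def int_index_poly_def)
  qed
  have val_comp: "comp1 (\<lambda>x. val (a x) (b x))" if "comp1 a" "comp1 b" for a b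
    unfolding val_def by (intro comp1_foldr I that comp1_comp1 [OF that(2)])

  have zero_iff: "fac (list_encode [one, i]) = 0 \<longleftrightarrow> e i = 0" for i
    by (rule zero_test [of e]) (use fac const_index in auto)
  define ok where "ok d i \<longleftrightarrow> (fac (list_encode [one, val d i]) = 0 \<longrightarrow>
    sentence_encode (root_sentence d) \<in> sentence_encode ` Ex_theory M)" for d i
  have ok: "ok d i \<longleftrightarrow> (poly (int_index_poly d) (e i) = 0 \<longrightarrow> (\<exists>x\<in>M. poly (int_index_poly d) x = 0))"
    for d i unfolding ok_def zero_iff val root_sentence_in_Ex_theory_iff ..
  have ok_comp: "comp1 (\<lambda>x. of_bool (ok (a x) (b x)))" if "comp1 a" "comp1 b" for a b
    unfolding ok_def list_encode.simps
    by (intro comp1_imp comp1_eq0 comp1_comp1 [OF Ex] comp1_comp1 [OF comp1_root_sentence] I val_comp that)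

  define bound where "bound s = foldr (\<lambda>i r. Suc r) (list_decode s) 0 *
    foldr (\<lambda>i r. eqn i * r) (list_decode s) 1" for s
  have bound: "bound s = length (list_decode s) * prod_list (map eqn (list_decode s))" for s
  proof -
    have "foldr (\<lambda>i r. Suc r) ks 0 = length ks" "foldr (\<lambda>i r. eqn i * r) ks 1 = prod_list (map eqn ks)"
      for ks :: "nat list" by (induction ks) simp_all
    then show ?thesis by (simp add: bound_def)
  qed
  have bound_comp: "comp1 bound" unfolding bound_def by (intro comp1_foldr I)

  have "comp1 (\<lambda>s. of_bool (\<forall>t\<le>bound s. \<forall>d\<le>code_bound (eqn (comb t (list_decode s))).
      ok d (comb t (list_decode s))))"
    by (intro comp1_all_le ok_comp bound_comp comp1_code_bound I comb_comp)
  then show ?thesis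
    unfolding ok bound simultaneous_automorphism_iff [OF alg M eqn comb] .
qed

lemma computable_conjugate:
  fixes e :: "nat \<Rightarrow> 'a::{alg_closed_field, field_char_0}"
  assumes alg: "\<forall>x::'a. algebraic x" and e: "standard_presentation e" and M: "is_subfield M"
    and Ex: "comp1 (\<lambda>c. of_bool (c \<in> sentence_encode ` Ex_theory M))"
  shows "\<exists>\<tau>. field_automorphism \<tau> \<and> is_subfield (\<tau> ` M) \<and>
    comp1 (\<lambda>i. of_bool (i \<in> {i. e i \<in> \<tau> ` M}))"
proof -
  define good where "good is \<longleftrightarrow> (\<exists>\<sigma>. field_automorphism \<sigma> \<and> (\<forall>i\<in>set is. \<sigma> (e i) \<in> M))" for "is"
  define cons where "cons i s = Suc (prod_encode (i, s))" for i s
  have cons: "list_decode (cons i s) = i # list_decode s" for i s by (simp add: cons_def)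
  \<comment> \<open>The code of the list of accepted indices below the argument; \<open>A\<close> is
    the acceptance test made against that list.\<close>
  define acc where "acc = rec_nat 0 (\<lambda>i s. if good (list_decode (cons i s)) then cons i s else s)"
  define A where "A i \<longleftrightarrow> good (list_decode (cons i (acc i)))" for i
  have acc_0: "acc 0 = 0" and acc_Suc: "acc (Suc i) = (if A i then cons i (acc i) else acc i)" for i
    by (simp_all add: acc_def A_def)
  have good_comp: "comp1 (\<lambda>x. of_bool (good (list_decode (a x))))" if "comp1 a" for a
    unfolding good_def
    using comp1_comp1 [OF computable_simultaneous_automorphism [OF alg e M Ex] that] .
  have "comp1 (\<lambda>x. acc x)" unfolding acc_def cons_def
    by (intro comp1_intros comp1_if good_comp)
  then have A_comp: "comp1 (\<lambda>i. of_bool (A i))"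
    unfolding A_def cons_def by (intro comp1_intros good_comp)
  have set_acc: "set (list_decode (acc n)) = {i. i < n \<and> A i}" for n
    by (induction n) (auto simp: acc_0 acc_Suc cons less_Suc_eq)
  have "field_automorphism (\<lambda>x::'a. x)"
    unfolding field_automorphism_def using bij_id [unfolded id_def] by simp
  then have "good (list_decode (acc n))" for n
  proof (induction n)
    case 0
    then show ?case by (auto simp: good_def acc_0)
  next
    case (Suc n)
    then show ?case by (simp add: acc_Suc A_def)
  qed
  \<comment> \<open>The automorphism \<open>t n\<close> works for everything accepted below
    \<open>n\<close>; the limit of these has to work for all accepted indices at once.\<close>
  then obtain t where t: "\<And>n. field_automorphism (t n)"
    "\<And>n i. i \<in> set (list_decode (acc n)) \<Longrightarrow> t n (e i) \<in> M"
    unfolding good_def by metis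
  have "range e = UNIV" using e unfolding standard_presentation_def by blast
  from automorphism_limit [OF alg this t(1)] obtain \<sigma> where "field_automorphism \<sigma> \<and>
    (\<forall>F. finite F \<longrightarrow> infinite {n. \<forall>x\<in>F. t n x = \<sigma> x})" by (rule exE)
  then have \<sigma>: "field_automorphism \<sigma>" "\<And>F. finite F \<Longrightarrow> infinite {n. \<forall>x\<in>F. t n x = \<sigma> x}"
    by simp_all
  have acc_in: "\<sigma> (e i) \<in> M" if "A i" for i
  proof -
    have "infinite {n. t n (e i) = \<sigma> (e i)}" using \<sigma>(2) [of "{e i}"] by simp
    \<comment> \<open>Agreement for infinitely many \<open>n\<close> permits a stage after
      \<open>i\<close> has been accepted.\<close>
    then obtain n where "n > i" "t n (e i) = \<sigma> (e i)"
      unfolding infinite_nat_iff_unbounded by auto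
    with t(2) [of i n] that show ?thesis by (simp add: set_acc)
  qed
  \<comment> \<open>If the limit moves \<open>e i\<close> into \<open>M\<close>, it witnesses the
    acceptance test for \<open>i\<close> itself, since it moves all earlier accepted elements into
    \<open>M\<close> as well.\<close>
  have "A i" if "\<sigma> (e i) \<in> M" for i
    unfolding A_def good_def cons using that acc_in \<sigma>(1) set_acc [of i] by (intro exI [of _ \<sigma>]) auto
  with acc_in have A_iff: "e i \<in> \<sigma> -` M \<longleftrightarrow> A i" for i by auto
  \<comment> \<open>The required automorphism is the inverse of the limit, as the limit moves the
    accepted elements into \<open>M\<close>.\<close>
  have eq: "inv \<sigma> ` M = \<sigma> -` M"
    using bij_vimage_eq_inv_image field_automorphism_simps(1) [OF \<sigma>(1)] by metis
  show ?thesis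
  proof (intro exI conjI)
    show "field_automorphism (inv \<sigma>)" by (rule field_automorphism_inv [OF \<sigma>(1)])
    show "is_subfield (inv \<sigma> ` M)" unfolding eq by (rule is_subfield_vimage [OF \<sigma>(1) M])
    show "comp1 (\<lambda>i. of_bool (i \<in> {i. e i \<in> inv \<sigma> ` M}))"
      using A_comp unfolding eq mem_Collect_eq A_iff .
  qed
qed

end

theorem theoremA:
  fixes e :: "nat \<Rightarrow> 'a::{alg_closed_field, field_char_0}"
    and M :: "'a set"
  assumes "\<forall>x::'a. algebraic x"
    and "standard_presentation e"
    and "is_subfield M"
  shows "(Ex_decidable M \<longrightarrow>
            (\<exists>\<tau>. field_automorphism \<tau> \<and> recursive_subfield e (\<tau> ` M))) \<and>
         (Ex_prim_decidable M \<longrightarrow>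
            (\<exists>\<tau>. field_automorphism \<tau> \<and> prim_rec_subfield e (\<tau> ` M)))"
  using recursive.computable_conjugate [OF assms] prim_rec.computable_conjugate [OF assms]
  unfolding Ex_decidable_def Ex_prim_decidable_def recursive_subfield_def prim_rec_subfield_def
    recursive_set_def prim_rec_set_def recursive.comp1_def prim_rec.comp1_def by blast

end
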